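(* Let $\Gamma=\{(\cosh t,\ \sinh t): t\ge 0\}\subset\mathbb R^2$ and let $\Lambda=\{(\cosh s,\ -\sinh s): s\in\mathbb R\}\subset\mathbb R^2$. Then $(\Gamma,\Lambda)$ is a Heisenberg uniqueness pair.
   Context: For a curve $\Gamma\subset\mathbb R^2$ (a finite disjoint union of smooth curves), $X(\Gamma)$ denotes the space of all finite complex-valued Borel measures $\mu$ on $\mathbb R^2$ that are supported on $\Gamma$ and absolutely continuous with respect to the arc length measure on $\Gamma$. The Fourier transform of $\mu$ is $\hat\mu(\xi,\eta)=\int_\Gamma e^{-i\pi(x\xi+y\eta)}\,d\mu(x,y)$ for $(\xi,\eta)\in\mathbb R^2$. For a set $\Lambda\subset\mathbb R^2$, the pair $(\Gamma,\Lambda)$ is a Heisenberg uniqueness pair (HUP) if every $\mu\in X(\Gamma)$ with $\hat\mu(\xi,\eta)=0$ for all $(\xi,\eta)\in\Lambda$ satisfies $\mu=0$. *)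

theory Defs
  imports "HOL-Analysis.Analysis"
begin

text \<open>A finite complex measure on the measurable space of \<open>M\<close> (whose own measure plays no role),
  as a countably additive set function; its values outside \<open>sets M\<close> are irrelevant.\<close>

definition complex_measure :: "'a measure \<Rightarrow> ('a set \<Rightarrow> complex) \<Rightarrow> bool" where
  "complex_measure M \<mu> \<longleftrightarrow> \<mu> {} = 0 \<and>
     (\<forall>A::nat \<Rightarrow> 'a set. range A \<subseteq> sets M \<longrightarrow> disjoint_family A \<longrightarrow>
        (\<lambda>n. \<mu> (A n)) sums \<mu> (\<Union>n. A n))"

text \<open>The positive part \<open>\<nu>\<^sup>+(A) = sup {\<nu>(B) | B \<subseteq> A}\<close> of the Jordan decomposition of a finite signed
  measure. Negative values are truncated by \<^const>\<open>ennreal\<close>, which is harmless since \<open>B = {}\<close> is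
  admitted. The negative part is the positive part of \<open>-\<nu>\<close>.\<close>

definition jordan_pos :: "'a measure \<Rightarrow> ('a set \<Rightarrow> real) \<Rightarrow> 'a measure" where
  "jordan_pos M \<nu> = measure_of (space M) (sets M)
     (\<lambda>A. SUP B \<in> {B \<in> sets M. B \<subseteq> A}. ennreal (\<nu> B))"

definition complex_measure_integral ::
    "'a measure \<Rightarrow> ('a set \<Rightarrow> complex) \<Rightarrow> ('a \<Rightarrow> complex) \<Rightarrow> complex" where
  "complex_measure_integral M \<mu> f =
     ((LINT x|jordan_pos M (\<lambda>A. Re (\<mu> A)). f x) - (LINT x|jordan_pos M (\<lambda>A. - Re (\<mu> A)). f x))
     + \<i> * ((LINT x|jordan_pos M (\<lambda>A. Im (\<mu> A)). f x) - (LINT x|jordan_pos M (\<lambda>A. - Im (\<mu> A)). f x))"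

text \<open>A regular injective \<open>C\<^sup>\<infinity>\<close> parametrization on a nondegenerate, possibly unbounded interval;
  \<open>D n\<close> is the \<open>n\<close>-th derivative, one-sided at endpoints belonging to \<open>T\<close>. Closed curves are
  covered by taking \<open>T\<close> half-open.\<close>

definition smooth_curve :: "(real \<Rightarrow> real \<times> real) \<Rightarrow> real set \<Rightarrow> bool" where
  "smooth_curve \<gamma> T \<longleftrightarrow> is_interval T \<and> interior T \<noteq> {} \<and> inj_on \<gamma> T \<and>
     (\<exists>D::nat \<Rightarrow> real \<Rightarrow> real \<times> real. D 0 = \<gamma> \<and>
        (\<forall>n. \<forall>t\<in>T. (D n has_vector_derivative D (Suc n) t) (at t within T)) \<and>
        (\<forall>t\<in>T. D 1 t \<noteq> 0))"

text \<open>\<open>\<Gamma>\<close> is a finite disjoint union of smooth curves and \<open>\<sigma>\<close> is the arc length measure on \<open>\<Gamma>\<close>, as a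
  Borel measure on the plane: the sum of the images of \<open>\<bar>\<gamma>\<^sub>i'(t)\<bar> dt\<close>. It does not depend
  on the choice of the parametrizations.\<close>

definition arc_length_measure :: "(real \<times> real) set \<Rightarrow> (real \<times> real) measure \<Rightarrow> bool" where
  "arc_length_measure \<Gamma> \<sigma> \<longleftrightarrow> sets \<sigma> = sets borel \<and>
     (\<exists>(k::nat) (\<gamma>::nat \<Rightarrow> real \<Rightarrow> real \<times> real) (T::nat \<Rightarrow> real set).
        (\<forall>i<k. smooth_curve (\<gamma> i) (T i)) \<and>
        disjoint_family_on (\<lambda>i. \<gamma> i ` T i) {..<k} \<and>
        \<Gamma> = (\<Union>i<k. \<gamma> i ` T i) \<and>
        (\<forall>A\<in>sets borel. emeasure \<sigma> A =
           (\<Sum>i<k. \<integral>\<^sup>+t\<in>{t \<in> T i. \<gamma> i t \<in> A}.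
              ennreal (norm (vector_derivative (\<gamma> i) (at t within T i))) \<partial>lborel)))"

definition ac_measures :: "(real \<times> real) set \<Rightarrow> ((real \<times> real) set \<Rightarrow> complex) set" where
  "ac_measures \<Gamma> = {\<mu>. complex_measure borel \<mu> \<and>
     (\<forall>A\<in>sets borel. A \<inter> \<Gamma> = {} \<longrightarrow> \<mu> A = 0) \<and>
     (\<exists>\<sigma>. arc_length_measure \<Gamma> \<sigma> \<and> (\<forall>A\<in>null_sets \<sigma>. \<mu> A = 0))}"

definition fourier :: "((real \<times> real) set \<Rightarrow> complex) \<Rightarrow> real \<times> real \<Rightarrow> complex" where
  "fourier \<mu> = (\<lambda>(\<xi>, \<eta>). complex_measure_integral borel \<mu>
     (\<lambda>(x, y). exp (- \<i> * complex_of_real (pi * (x * \<xi> + y * \<eta>)))))"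

text \<open>The first conjunct is the standing assumption on \<open>\<Gamma>\<close>; without it \<open>ac_measures \<Gamma>\<close> would be empty and
  the condition vacuous.\<close>

definition heisenberg_uniqueness_pair :: "(real \<times> real) set \<Rightarrow> (real \<times> real) set \<Rightarrow> bool" where
  "heisenberg_uniqueness_pair \<Gamma> \<Lambda> \<longleftrightarrow> (\<exists>\<sigma>. arc_length_measure \<Gamma> \<sigma>) \<and>
     (\<forall>\<mu>\<in>ac_measures \<Gamma>. (\<forall>p\<in>\<Lambda>. fourier \<mu> p = 0) \<longrightarrow> (\<forall>A\<in>sets borel. \<mu> A = 0))"

end

theory Submission
  imports Defs "HOL-Complex_Analysis.Conformal_Mappings" "HOL-Probability.Distribution_Functions"
    "HOL-Real_Asymp.Real_Asymp"
begin

text \<open>On \<open>\<Gamma>\<close> put \<open>x = e\<^sup>t \<ge> 1\<close>. With \<open>q = \<pi>\<^sup>2/4\<close> and \<open>v = \<pi>e\<^sup>-\<^sup>s/2\<close> the phase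
  \<open>\<pi> cosh (t - s)\<close> is \<open>xv + q/(xv)\<close>, so the hypothesis says that
  \<open>H(w) = \<integral> exp (-xw + q/(xw)) d\<mu>\<close> vanishes for \<open>w = \<i>v\<close>, \<open>v > 0\<close>. As \<open>x \<ge> 1\<close>, \<open>H\<close> is holomorphic for
  \<open>Re w > 0\<close> and continuous up to the imaginary axis away from \<open>0\<close>, so reflection gives \<open>H = 0\<close>.
  Expanding \<open>exp (q/(xw))\<close>, for real \<open>w\<close> this reads \<open>\<Sum>\<^sub>n (q/w)\<^sup>n/n! E\<^sub>n(w) = 0\<close> with
  \<open>E\<^sub>n(w) = \<integral> x\<^sup>-\<^sup>n exp (-xw) d\<mu>\<close>. Since \<open>E\<^sub>n\<^sub>+\<^sub>1' = -E\<^sub>n\<close>, a bound \<open>M e\<^sup>-\<^sup>w\<close> for \<open>E\<^sub>0\<close> is inherited by all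
  \<open>E\<^sub>n\<close>, and the equation improves it by the factor \<open>e\<^sup>q\<^sup>/\<^sup>w - 1 < 1\<close> for large \<open>w\<close>. Hence the Laplace
  transform \<open>E\<^sub>0\<close> of \<open>\<mu>\<close> vanishes for large \<open>w\<close>, and Weierstrass approximation applied to \<open>e\<^sup>-\<^sup>x\<close>
  shows \<open>\<mu> = 0\<close>.\<close>

subsection \<open>Vector measures and the Jordan decomposition\<close>

text \<open>The axioms of \<open>complex_measure\<close> with values in any normed space, so that
  real and imaginary parts can be treated as signed measures.\<close>

definition vector_measure :: "'a measure \<Rightarrow> ('a set \<Rightarrow> 'b::real_normed_vector) \<Rightarrow> bool" where
  "vector_measure M \<nu> \<longleftrightarrow> \<nu> {} = 0 \<and>
     (\<forall>A::nat \<Rightarrow> 'a set. range A \<subseteq> sets M \<longrightarrow> disjoint_family A \<longrightarrow>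
        (\<lambda>n. \<nu> (A n)) sums \<nu> (\<Union>n. A n))"

lemma vector_measure_empty: "vector_measure M \<nu> \<Longrightarrow> \<nu> {} = 0"
  by (simp add: vector_measure_def)

lemma vector_measure_sums:
  "vector_measure M \<nu> \<Longrightarrow> range A \<subseteq> sets M \<Longrightarrow> disjoint_family A \<Longrightarrow> (\<lambda>n. \<nu> (A n)) sums \<nu> (\<Union>n. A n)"
  by (simp add: vector_measure_def)

lemma vector_measure_Un:
  assumes "vector_measure M \<nu>" "A \<in> sets M" "B \<in> sets M" "A \<inter> B = {}"
  shows "\<nu> (A \<union> B) = \<nu> A + \<nu> B"
proof -
  have "(\<lambda>n. \<nu> (binaryset A B n)) sums \<nu> (\<Union>n. binaryset A B n)"
    using assms
    by (intro vector_measure_sums[OF assms(1)])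
       (auto simp: range_binaryset_eq disjoint_family_on_def binaryset_def)
  moreover have "(\<lambda>n. \<nu> (binaryset A B n)) sums (\<nu> A + \<nu> B)"
    using binaryset_sums[of \<nu>] vector_measure_empty[OF assms(1)] by blast
  ultimately show ?thesis by (simp add: UN_binaryset_eq sums_unique2)
qed

lemma vector_measure_Diff:
  assumes "vector_measure M \<nu>" "A \<in> sets M" "B \<in> sets M" "B \<subseteq> A"
  shows "\<nu> (A - B) = \<nu> A - \<nu> B"
  using vector_measure_Un[of M \<nu> B "A - B"] assms by (simp add: Un_absorb1)

lemma vector_measure_uminus: "vector_measure M \<nu> \<Longrightarrow> vector_measure M (\<lambda>A. - \<nu> A)"
  by (auto simp: vector_measure_def intro: sums_minus)

text \<open>The terms of a convergent series tend to 0, so countable additivity excludes infinitely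
  many disjoint sets whose values have norm at least 1; an unbounded range would produce such a
  family. \<open>unb A\<close> says that the values on subsets of \<open>A\<close> are unbounded,
  and \<open>split\<close> that this passes to one of two complementary pieces.\<close>

lemma vector_measure_bounded:
  assumes \<nu>: "vector_measure M \<nu>"
  obtains C where "\<And>A. A \<in> sets M \<Longrightarrow> norm (\<nu> A) \<le> C"
proof -
  define unb where "unb = (\<lambda>A. A \<in> sets M \<and> (\<forall>C. \<exists>B\<in>sets M. B \<subseteq> A \<and> norm (\<nu> B) > C))"
  have split: "unb B \<or> unb (A - B)" if "unb A" "B \<in> sets M" "B \<subseteq> A" for A B
  proof (rule ccontr)
    assume "\<not> ?thesis"
    moreover have "A \<in> sets M" using that by (simp add: unb_def)
    ultimately obtain C D where C: "\<And>E. E \<in> sets M \<Longrightarrow> E \<subseteq> B \<Longrightarrow> norm (\<nu> E) \<le> C"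
      and D: "\<And>E. E \<in> sets M \<Longrightarrow> E \<subseteq> A - B \<Longrightarrow> norm (\<nu> E) \<le> D"
      using \<open>B \<in> sets M\<close> unfolding unb_def by (metis not_le sets.Diff)
    have "norm (\<nu> E) \<le> C + D" if E: "E \<in> sets M" "E \<subseteq> A" for E
    proof -
      have "\<nu> E = \<nu> (E \<inter> B) + \<nu> (E - B)"
        using vector_measure_Un[OF \<nu>, of "E \<inter> B" "E - B"] E \<open>B \<in> sets M\<close>
        by (auto simp: Int_Diff_Un)
      moreover have "norm (\<nu> (E \<inter> B)) \<le> C" "norm (\<nu> (E - B)) \<le> D"
        using C[of "E \<inter> B"] D[of "E - B"] E \<open>B \<in> sets M\<close> by auto
      ultimately show ?thesis using norm_triangle_ineq[of "\<nu> (E \<inter> B)" "\<nu> (E - B)"] by simp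
    qed
    then show False using \<open>unb A\<close> unfolding unb_def by (meson not_le)
  qed
  \<comment> \<open>if the range were unbounded, pieces of norm at least 1 could be cut off again and again\<close>
  have step: "\<exists>B. unb B \<and> B \<subseteq> A \<and> norm (\<nu> (A - B)) \<ge> 1" if A: "unb A" for A
  proof -
    have "A \<in> sets M" using A by (simp add: unb_def)
    \<comment> \<open>The surplus over \<open>norm (\<nu> A)\<close> gives both \<open>B\<close> and
      \<open>A - B\<close> a value of norm at least 1, so whichever of them stays unbounded, the
      other is the piece cut off.\<close>
    obtain B where B: "B \<in> sets M" "B \<subseteq> A" "norm (\<nu> B) > norm (\<nu> A) + 1"
      using A unfolding unb_def by blast
    have "\<nu> (A - B) = \<nu> A - \<nu> B" using vector_measure_Diff[OF \<nu> \<open>A \<in> sets M\<close>] B by auto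
    then have "norm (\<nu> (A - B)) \<ge> 1"
      using B(3) norm_triangle_ineq2[of "\<nu> B" "\<nu> A"] by (simp add: norm_minus_commute)
    moreover have "norm (\<nu> (A - (A - B))) \<ge> 1"
      using B norm_ge_zero[of "\<nu> A"] by (simp add: double_diff del: norm_ge_zero)
    ultimately show ?thesis using split[OF A B(1,2)] by (metis B(2) Diff_subset)
  qed
  have "\<not> unb (space M)"
  proof
    assume "unb (space M)"
    then have "\<exists>A. \<forall>n::nat. unb (A n) \<and> A (Suc n) \<subseteq> A n \<and> norm (\<nu> (A n - A (Suc n))) \<ge> 1"
      using dependent_nat_choice[of "\<lambda>_. unb" "\<lambda>_ A B. B \<subseteq> A \<and> norm (\<nu> (A - B)) \<ge> 1"] step
      by blast
    then obtain A :: "nat \<Rightarrow> _" where A: "\<And>n. unb (A n)" "\<And>n. A (Suc n) \<subseteq> A n"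
      and large: "\<And>n. norm (\<nu> (A n - A (Suc n))) \<ge> 1" by blast
    have anti: "A m \<subseteq> A n" if "n \<le> m" for m n
      using A(2) that by (rule lift_Suc_antimono_le)
    have "disjoint_family (\<lambda>n. A n - A (Suc n))"
    proof -
      have "(A m - A (Suc m)) \<inter> (A n - A (Suc n)) = {}" if "m < n" for m n
        using anti[of "Suc m" n] that by auto
      then show ?thesis unfolding disjoint_family_on_def
        by (metis Int_commute linorder_neqE_nat)
    qed
    moreover have "range (\<lambda>n. A n - A (Suc n)) \<subseteq> sets M"
      using A(1) by (auto simp: unb_def)
    ultimately have "(\<lambda>n. \<nu> (A n - A (Suc n))) \<longlonglongrightarrow> 0"
      using vector_measure_sums[OF \<nu>] sums_summable summable_LIMSEQ_zero by blast
    then have "\<forall>\<^sub>F n in sequentially. norm (\<nu> (A n - A (Suc n))) < 1"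
      by (auto dest: tendstoD[of _ _ _ 1])
    then show False using large by (auto simp: eventually_sequentially not_less[symmetric])
  qed
  then obtain C where "\<And>B. B \<in> sets M \<Longrightarrow> B \<subseteq> space M \<Longrightarrow> norm (\<nu> B) \<le> C"
    unfolding unb_def by (metis not_less sets.top)
  then show ?thesis using that[of C] sets.sets_into_space[of _ M] by blast
qed

text \<open>\<open>ennreal\<close> truncates negative terms to 0, so the right-hand side sums the
  positive parts and dominates every partial sum.\<close>

lemma ennreal_le_suminf:
  assumes "a sums s"
  shows "ennreal s \<le> (\<Sum>n. ennreal (a n))"
proof -
  have "ennreal (\<Sum>k<n. a k) \<le> (\<Sum>n. ennreal (a n))" for n
  proof -
    have "ennreal (\<Sum>k<n. a k) \<le> ennreal (\<Sum>k<n. max 0 (a k))"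
      by (intro ennreal_leI sum_mono) auto
    also have "\<dots> = (\<Sum>k<n. ennreal (a k))"
      by (subst sum_ennreal[symmetric]) (auto simp: ennreal_max_0)
    also have "\<dots> \<le> (\<Sum>n. ennreal (a n))"
      by (rule sum_le_suminf) auto
    finally show ?thesis .
  qed
  moreover have "(\<lambda>n. ennreal (\<Sum>k<n. a k)) \<longlonglongrightarrow> ennreal s"
    using assms unfolding sums_def by (rule tendsto_ennrealI)
  ultimately show ?thesis by (intro LIMSEQ_le_const2) auto
qed

section \<open>Positive parts and the Jordan decomposition of signed measures\<close>

lemma sets_jordan_pos [simp, measurable_cong]: "sets (jordan_pos M \<nu>) = sets M"
  unfolding jordan_pos_def by simp

lemma space_jordan_pos [simp]: "space (jordan_pos M \<nu>) = space M"
  unfolding jordan_pos_def by simp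

text \<open>\<open>measure_of\<close> is known to reproduce its set function once this is positive
  and countably additive on \<open>sets M\<close>. Joining subsets of disjoint sets gives
  superadditivity, hence one inequality; cutting a subset of the union along the partition gives the
  other.\<close>

lemma emeasure_jordan_pos:
  assumes \<nu>: "vector_measure M \<nu>" and "A \<in> sets M"
  shows "emeasure (jordan_pos M \<nu>) A = (SUP B \<in> {B \<in> sets M. B \<subseteq> A}. ennreal (\<nu> B))"
proof -
  let ?P = "\<lambda>A. SUP B \<in> {B \<in> sets M. B \<subseteq> A}. ennreal (\<nu> B)"
  have upper: "ennreal (\<nu> B) \<le> ?P A" if "B \<in> sets M" "B \<subseteq> A" for A B
    using that by (intro SUP_upper) auto
  have "?P {} = 0"
    by (intro antisym SUP_least) (auto simp: vector_measure_empty[OF \<nu>])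
  then have "positive (sets M) ?P" by (simp add: positive_def)
  have superadd: "?P A + ?P B \<le> ?P (A \<union> B)" if "A \<in> sets M" "B \<in> sets M" "A \<inter> B = {}" for A B
  proof -
    have ne: "{B \<in> sets M. B \<subseteq> A} \<noteq> {}" for A :: "'a set" by auto
    have "ennreal (\<nu> C) + ennreal (\<nu> D) \<le> ?P (A \<union> B)"
      if C: "C \<in> sets M" "C \<subseteq> A" and D: "D \<in> sets M" "D \<subseteq> B" for C D
    proof (cases "\<nu> C \<ge> 0 \<and> \<nu> D \<ge> 0")
      case True
      have "C \<inter> D = {}" using C D \<open>A \<inter> B = {}\<close> by auto
      then have "ennreal (\<nu> C) + ennreal (\<nu> D) = ennreal (\<nu> (C \<union> D))"
        using vector_measure_Un[OF \<nu>, of C D] C D True by simp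
      also have "\<dots> \<le> ?P (A \<union> B)" using C D by (intro upper) auto
      finally show ?thesis .
    next
      case False
      \<comment> \<open>At least one value is truncated to 0, so the sum is one of its two
        summands.\<close>
      then have "ennreal (\<nu> C) + ennreal (\<nu> D) \<in> {ennreal (\<nu> C), ennreal (\<nu> D)}"
        by (auto simp: ennreal_neg not_le)
      moreover have "C \<subseteq> A \<union> B" "D \<subseteq> A \<union> B" using C D by auto
      ultimately show ?thesis using upper[of C "A \<union> B"] upper[of D "A \<union> B"] C D by auto
    qed
    then have "ennreal (\<nu> C) + ?P B \<le> ?P (A \<union> B)" if "C \<in> sets M" "C \<subseteq> A" for C
      unfolding ennreal_SUP_add_right[OF ne] using that by (intro SUP_least) auto
    then show ?thesis
      unfolding ennreal_SUP_add_left[OF ne, symmetric] by (intro SUP_least) auto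
  qed
  have mono: "?P A \<le> ?P B" if "A \<subseteq> B" for A B
    using that by (intro SUP_subset_mono) auto
  have "countably_additive (sets M) ?P"
  proof (rule countably_additiveI)
    fix A :: "nat \<Rightarrow> 'a set"
    assume A: "range A \<subseteq> sets M" "disjoint_family A"
    show "(\<Sum>n. ?P (A n)) = ?P (\<Union>n. A n)"
    proof (rule antisym)
      have "(\<Sum>k<n. ?P (A k)) \<le> ?P (\<Union>k<n. A k)" for n
      proof (induction n)
        case (Suc n)
        have "A k \<inter> A n = {}" if "k < n" for k
          using A(2) that by (simp add: disjoint_family_on_def)
        then have "(\<Union>k<n. A k) \<inter> A n = {}" by auto
        then have "?P (\<Union>k<n. A k) + ?P (A n) \<le> ?P ((\<Union>k<n. A k) \<union> A n)"
          using A(1) by (intro superadd) auto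
        also have "(\<Union>k<n. A k) \<union> A n = (\<Union>k<Suc n. A k)" by (auto simp: lessThan_Suc)
        finally show ?case using Suc by (auto intro: order_trans add_right_mono)
      qed auto
      also have "?P (\<Union>k<n. A k) \<le> ?P (\<Union>n. A n)" for n by (rule mono) auto
      finally show "(\<Sum>n. ?P (A n)) \<le> ?P (\<Union>n. A n)"
        by (intro suminf_le_const) auto
      show "?P (\<Union>n. A n) \<le> (\<Sum>n. ?P (A n))"
      proof (rule SUP_least)
        fix B assume "B \<in> {B \<in> sets M. B \<subseteq> (\<Union>n. A n)}"
        then have B: "B \<in> sets M" "B = (\<Union>n. B \<inter> A n)" by auto
        have "(\<lambda>n. \<nu> (B \<inter> A n)) sums \<nu> (\<Union>n. B \<inter> A n)"
          using A B(1) by (intro vector_measure_sums[OF \<nu>]) (auto simp: disjoint_family_on_def)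
        then have "ennreal (\<nu> B) \<le> (\<Sum>n. ennreal (\<nu> (B \<inter> A n)))"
          using B(2) ennreal_le_suminf by fastforce
        also have "\<dots> \<le> (\<Sum>n. ?P (A n))"
          using A(1) B(1) by (intro suminf_le upper) auto
        finally show "ennreal (\<nu> B) \<le> (\<Sum>n. ?P (A n))" .
      qed
    qed
  qed
  then show ?thesis
    using emeasure_measure_of_sigma[OF sets.sigma_algebra_axioms \<open>positive (sets M) ?P\<close>] \<open>A \<in> sets M\<close>
    unfolding jordan_pos_def by blast
qed

lemma finite_measure_jordan_pos:
  assumes \<nu>: "vector_measure M \<nu>"
  shows "finite_measure (jordan_pos M \<nu>)"
proof (rule finite_measureI)
  obtain C where C: "\<And>A. A \<in> sets M \<Longrightarrow> norm (\<nu> A) \<le> C"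
    using vector_measure_bounded[OF \<nu>] by blast
  have "emeasure (jordan_pos M \<nu>) (space M) \<le> ennreal C"
    by (subst emeasure_jordan_pos[OF \<nu>]) (use C in \<open>auto intro!: SUP_least ennreal_leI simp: abs_le_iff\<close>)
  then show "emeasure (jordan_pos M \<nu>) (space (jordan_pos M \<nu>)) \<noteq> \<infinity>"
    by (metis ennreal_less_top infinity_ennreal_def leD space_jordan_pos)
qed

text \<open>For \<open>B \<subseteq> A\<close>, the value on \<open>B\<close> is the value on
  \<open>A\<close> minus that on \<open>A - B\<close>, hence at most \<open>\<nu> A\<close> plus the
  negative part of \<open>A\<close>. The supremum over \<open>B\<close> gives one inequality, and
  the same argument for \<open>- \<nu>\<close> the other.\<close>

lemma jordan_decomposition:
  assumes \<nu>: "vector_measure M \<nu>" and A: "A \<in> sets M"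
  shows "\<nu> A = measure (jordan_pos M \<nu>) A - measure (jordan_pos M (\<lambda>A. - \<nu> A)) A"
proof -
  have le: "measure (jordan_pos M \<mu>) A - \<mu> A \<le> measure (jordan_pos M (\<lambda>A. - \<mu> A)) A"
    if \<mu>: "vector_measure M \<mu>" for \<mu>
  proof -
    let ?N = "jordan_pos M (\<lambda>A. - \<mu> A)"
    interpret P: finite_measure "jordan_pos M \<mu>" by (rule finite_measure_jordan_pos[OF \<mu>])
    interpret N: finite_measure ?N
      by (rule finite_measure_jordan_pos[OF vector_measure_uminus[OF \<mu>]])
    have N: "- \<mu> B \<le> measure ?N A" if "B \<in> sets M" "B \<subseteq> A" for B
    proof -
      have "ennreal (- \<mu> B) \<le> emeasure ?N A"
        by (subst emeasure_jordan_pos[OF vector_measure_uminus[OF \<mu>] A]) (use that in \<open>auto intro: SUP_upper\<close>)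
      then show ?thesis by (simp add: N.emeasure_eq_measure)
    qed
    have "emeasure (jordan_pos M \<mu>) A \<le> ennreal (\<mu> A + measure ?N A)"
      unfolding emeasure_jordan_pos[OF \<mu> A]
    proof (rule SUP_least, clarify)
      fix B assume B: "B \<in> sets M" "B \<subseteq> A"
      have "\<mu> B \<le> \<mu> A + measure ?N A"
        using N[of "A - B"] vector_measure_Diff[OF \<mu> A B] A B by auto
      then show "ennreal (\<mu> B) \<le> ennreal (\<mu> A + measure ?N A)" by (rule ennreal_leI)
    qed
    moreover have "0 \<le> \<mu> A + measure ?N A" using N[OF A] by simp
    ultimately show ?thesis by (simp add: P.emeasure_eq_measure)
  qed
  show ?thesis using le[OF \<nu>] le[OF vector_measure_uminus[OF \<nu>]] by simp
qed

text \<open>Turns the support condition on a measure into null sets of its Jordan parts.\<close>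

lemma jordan_pos_null:
  assumes \<nu>: "vector_measure M \<nu>" and "A \<in> sets M" and "\<And>B. B \<in> sets M \<Longrightarrow> B \<subseteq> A \<Longrightarrow> \<nu> B = 0"
  shows "A \<in> null_sets (jordan_pos M \<nu>)"
proof
  have "emeasure (jordan_pos M \<nu>) A \<le> 0"
    unfolding emeasure_jordan_pos[OF assms(1,2)] by (rule SUP_least) (use assms in auto)
  then show "emeasure (jordan_pos M \<nu>) A = 0" by simp
qed (use assms in simp)

subsection \<open>Integrals depending on a complex parameter\<close>

text \<open>Dominated convergence along sequences; the constant bound is integrable because the
  measure is finite.\<close>

lemma (in finite_measure) continuous_on_integral_parameter:
  fixes f :: "'a \<Rightarrow> 'b::metric_space \<Rightarrow> complex"
  assumes cont: "\<And>x. continuous_on S (f x)"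
    and bound: "\<And>x w. w \<in> S \<Longrightarrow> norm (f x w) \<le> C"
    and meas: "\<And>w. w \<in> S \<Longrightarrow> (\<lambda>x. f x w) \<in> borel_measurable M"
  shows "continuous_on S (\<lambda>w. \<integral>x. f x w \<partial>M)"
  unfolding continuous_on_sequentially
proof (intro allI ballI impI)
  fix y a assume a: "a \<in> S" and y: "(\<forall>n. y n \<in> S) \<and> y \<longlonglongrightarrow> a"
  show "((\<lambda>w. \<integral>x. f x w \<partial>M) \<circ> y) \<longlonglongrightarrow> (\<integral>x. f x a \<partial>M)"
    unfolding o_def
  proof (rule integral_dominated_convergence[where w = "\<lambda>_. C"])
    show "AE x in M. (\<lambda>n. f x (y n)) \<longlonglongrightarrow> f x a"
      using cont a y unfolding continuous_on_sequentially o_def by blast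
  qed (use a y bound meas in auto)
qed

text \<open>By the mean value inequality on the convex ball, the bound for \<open>f'\<close> also
  bounds the difference quotients, so dominated convergence applies to them.\<close>

lemma (in finite_measure) has_field_derivative_integral_parameter:
  fixes f :: "'a \<Rightarrow> complex \<Rightarrow> complex"
  assumes "r > 0"
    and deriv: "\<And>x w. w \<in> ball a r \<Longrightarrow> (f x has_field_derivative f' x w) (at w)"
    and bound: "\<And>x w. w \<in> ball a r \<Longrightarrow> norm (f' x w) \<le> C"
    and int: "\<And>w. w \<in> ball a r \<Longrightarrow> integrable M (\<lambda>x. f x w)"
    and meas: "(\<lambda>x. f' x a) \<in> borel_measurable M"
  shows "((\<lambda>w. \<integral>x. f x w \<partial>M) has_field_derivative (\<integral>x. f' x a \<partial>M)) (at a)"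
  unfolding has_field_derivative_iff tendsto_at_iff_sequentially
proof (intro allI impI)
  fix y :: "nat \<Rightarrow> complex" assume y: "\<forall>n. y n \<in> UNIV - {a}" and lim: "y \<longlonglongrightarrow> a"
  have aball: "a \<in> ball a r" using \<open>r > 0\<close> by simp
  have "\<forall>\<^sub>F n in sequentially. y n \<in> ball a r"
    using lim aball by (metis open_ball topological_tendstoD)
  then obtain N where N: "\<And>n. n \<ge> N \<Longrightarrow> y n \<in> ball a r"
    by (auto simp: eventually_sequentially)
  \<comment> \<open>Dropping the first \<open>N\<close> terms keeps the whole sequence in the
    ball.\<close>
  define z where "z = (\<lambda>n. y (n + N))"
  have z: "z n \<in> ball a r" "z n \<noteq> a" for n
    using N y by (auto simp: z_def)
  have zlim: "z \<longlonglongrightarrow> a" unfolding z_def by (rule LIMSEQ_ignore_initial_segment[OF lim])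
  have "(\<lambda>n. \<integral>x. (f x (z n) - f x a) / (z n - a) \<partial>M) \<longlonglongrightarrow> (\<integral>x. f' x a \<partial>M)"
  proof (rule integral_dominated_convergence[where w = "\<lambda>_. C"])
    show "AE x in M. (\<lambda>n. (f x (z n) - f x a) / (z n - a)) \<longlonglongrightarrow> f' x a"
      using deriv[OF aball] z zlim
      unfolding has_field_derivative_iff tendsto_at_iff_sequentially o_def by auto
    have "norm (f x (z n) - f x a) \<le> C * norm (z n - a)" for x n
      by (rule field_differentiable_bound[of "ball a r" "f x" "f' x"])
         (use deriv bound z aball in \<open>auto intro: has_field_derivative_at_within\<close>)
    then show "AE x in M. norm ((f x (z n) - f x a) / (z n - a)) \<le> C" for n
      using z by (auto simp: norm_divide divide_simps)
    show "(\<lambda>x. (f x (z n) - f x a) / (z n - a)) \<in> borel_measurable M" for n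
      using int[OF z(1)] int[OF aball] by (auto dest!: borel_measurable_integrable)
  qed (use meas in auto)
  also have "(\<lambda>n. \<integral>x. (f x (z n) - f x a) / (z n - a) \<partial>M)
     = (\<lambda>n. ((\<integral>x. f x (z n) \<partial>M) - (\<integral>x. f x a \<partial>M)) / (z n - a))"
    using int[OF z(1)] int[OF aball] by (simp add: Bochner_Integration.integral_diff)
  finally show "((\<lambda>w. ((\<integral>x. f x w \<partial>M) - (\<integral>x. f x a \<partial>M)) / (w - a)) \<circ> y) \<longlonglongrightarrow> (\<integral>x. f' x a \<partial>M)"
    unfolding z_def o_def by (rule LIMSEQ_offset)
qed

subsection \<open>Laplace-type transforms of linear combinations of measures\<close>

text \<open>Models a complex measure by finite positive measures \<open>P j\<close> with
  coefficients \<open>c j\<close>. \<open>X\<close> is the variable x of the overview; its lower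
  bound is assumed everywhere, so that estimates of integrands hold pointwise.\<close>

locale measure_combination =
  fixes J :: "'j set" and c :: "'j \<Rightarrow> complex" and P :: "'j \<Rightarrow> 'a measure" and X :: "'a \<Rightarrow> real"
  assumes finite_J: "finite J"
    and finite_P: "j \<in> J \<Longrightarrow> finite_measure (P j)"
    and X_measurable: "j \<in> J \<Longrightarrow> X \<in> borel_measurable (P j)"
    and X_ge_1: "1 \<le> X x"
begin

definition comb :: "('a \<Rightarrow> complex) \<Rightarrow> complex" where
  "comb f = (\<Sum>j\<in>J. c j * (\<integral>x. f x \<partial>P j))"

lemma comb_cmult: "comb (\<lambda>x. k * f x) = k * comb f"
  by (simp add: comb_def sum_distrib_left mult.left_commute)

definition total_mass :: real where
  "total_mass = (\<Sum>j\<in>J. norm (c j) * measure (P j) (space (P j)))"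

lemma total_mass_nonneg: "0 \<le> total_mass"
  unfolding total_mass_def by (intro sum_nonneg) auto

lemma integrable_bounded:
  assumes "j \<in> J" "f \<in> borel_measurable (P j)" "\<And>x. norm (f x :: complex) \<le> B"
  shows "integrable (P j) f"
  by (rule finite_measure.integrable_const_bound[OF finite_P[OF assms(1)], of f B])
     (simp_all add: assms(2,3))

lemma norm_comb_le:
  assumes "\<And>j. j \<in> J \<Longrightarrow> f \<in> borel_measurable (P j)" "\<And>x. norm (f x) \<le> B"
  shows "norm (comb f) \<le> B * total_mass"
proof -
  have "norm (\<integral>x. f x \<partial>P j) \<le> B * measure (P j) (space (P j))" if "j \<in> J" for j
  proof -
    interpret finite_measure "P j" by (rule finite_P[OF that])
    have "norm (\<integral>x. f x \<partial>P j) \<le> (\<integral>x. norm (f x) \<partial>P j)" by simp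
    also have "\<dots> \<le> (\<integral>x. B \<partial>P j)"
      using integrable_bounded[OF that assms(1)[OF that] assms(2)] assms(2)
      by (intro integral_mono) auto
    finally show ?thesis by (simp add: mult.commute)
  qed
  then have "norm (comb f) \<le> (\<Sum>j\<in>J. norm (c j) * (B * measure (P j) (space (P j))))"
    unfolding comb_def by (intro sum_norm_le) (auto simp: norm_mult intro!: mult_left_mono)
  then show ?thesis by (simp add: total_mass_def sum_distrib_left algebra_simps)
qed

text \<open>Constants are integrable over each \<open>P j\<close>, so the summable bounds
  \<open>b n\<close> also make the integrals of the norms summable, which justifies integrating term
  by term.\<close>

lemma comb_sums:
  assumes meas: "\<And>j n. j \<in> J \<Longrightarrow> f n \<in> borel_measurable (P j)"
    and bound: "\<And>n x. norm (f n x) \<le> b n" and "summable b"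
    and sums: "\<And>x. (\<lambda>n. f n x) sums g x"
  shows "(\<lambda>n. comb (f n)) sums comb g"
  unfolding comb_def
proof (intro sums_sum sums_mult)
  fix j assume j: "j \<in> J"
  interpret finite_measure "P j" by (rule finite_P[OF j])
  have int: "integrable (P j) (f n)" for n
    by (rule integrable_bounded[OF j meas[OF j] bound])
  have "(\<integral>x. norm (f n x) \<partial>P j) \<le> b n * measure (P j) (space (P j))" for n
  proof -
    have "(\<integral>x. norm (f n x) \<partial>P j) \<le> (\<integral>x. b n \<partial>P j)"
      using int bound by (intro integral_mono) auto
    then show ?thesis by (simp add: mult.commute)
  qed
  then have "summable (\<lambda>n. \<integral>x. norm (f n x) \<partial>P j)"
    using \<open>summable b\<close>
    by (intro summable_comparison_test'[OF summable_mult2[OF \<open>summable b\<close>, of "measure (P j) (space (P j))"], of 0]) auto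
  moreover have "summable (\<lambda>n. norm (f n x))" for x
    using bound by (intro summable_comparison_test'[OF \<open>summable b\<close>, of 0]) auto
  ultimately have "(\<lambda>n. integral\<^sup>L (P j) (f n)) sums (\<integral>x. (\<Sum>n. f n x) \<partial>P j)"
    using int by (intro sums_integral) auto
  moreover have "(\<lambda>x. \<Sum>n. f n x) = g" using sums by (auto simp: sums_iff)
  ultimately show "(\<lambda>n. integral\<^sup>L (P j) (f n)) sums integral\<^sup>L (P j) g" by simp
qed

lemma continuous_on_comb:
  fixes f :: "'a \<Rightarrow> 'b::metric_space \<Rightarrow> complex"
  assumes "\<And>x. continuous_on S (f x)"
    and "\<And>x w. w \<in> S \<Longrightarrow> norm (f x w) \<le> C"
    and "\<And>w j. w \<in> S \<Longrightarrow> j \<in> J \<Longrightarrow> (\<lambda>x. f x w) \<in> borel_measurable (P j)"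
  shows "continuous_on S (\<lambda>w. comb (\<lambda>x. f x w))"
  unfolding comb_def
  by (intro continuous_on_sum continuous_on_mult continuous_on_const
      finite_measure.continuous_on_integral_parameter[OF finite_P, where C = C])
     (use assms in auto)

lemma has_field_derivative_comb:
  fixes f :: "'a \<Rightarrow> complex \<Rightarrow> complex"
  assumes "r > 0"
    and "\<And>x w. w \<in> ball a r \<Longrightarrow> (f x has_field_derivative f' x w) (at w)"
    and "\<And>x w. w \<in> ball a r \<Longrightarrow> norm (f' x w) \<le> C"
    and bound: "\<And>x w. w \<in> ball a r \<Longrightarrow> norm (f x w) \<le> B"
    and meas: "\<And>w j. w \<in> ball a r \<Longrightarrow> j \<in> J \<Longrightarrow> (\<lambda>x. f x w) \<in> borel_measurable (P j)"
    and "\<And>j. j \<in> J \<Longrightarrow> (\<lambda>x. f' x a) \<in> borel_measurable (P j)"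
  shows "((\<lambda>w. comb (\<lambda>x. f x w)) has_field_derivative comb (\<lambda>x. f' x a)) (at a)"
  unfolding comb_def
proof (intro DERIV_sum DERIV_cmult)
  fix j assume j: "j \<in> J"
  show "((\<lambda>w. \<integral>x. f x w \<partial>P j) has_field_derivative (\<integral>x. f' x a \<partial>P j)) (at a)"
    using finite_measure.has_field_derivative_integral_parameter[OF finite_P[OF j] assms(1-3) _ assms(6)[OF j]]
      integrable_bounded[OF j meas[OF _ j] bound] by blast
qed

section \<open>Iterated antiderivatives of the Laplace transform and their decay\<close>

definition weighted_laplace :: "nat \<Rightarrow> complex \<Rightarrow> complex" where
  "weighted_laplace n w = comb (\<lambda>x. (1 / complex_of_real (X x)) ^ n * exp (- (complex_of_real (X x) * w)))"

lemma X_pos: "0 < X x" using X_ge_1[of x] by linarith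

lemma inverse_X_power_le: "norm ((1 / complex_of_real (X x)) ^ n) \<le> 1"
  using X_ge_1[of x] by (auto simp: norm_power norm_divide intro!: power_le_one)

lemma weighted_laplace_measurable [measurable]:
  "j \<in> J \<Longrightarrow> (\<lambda>x. (1 / complex_of_real (X x)) ^ n * exp (- (complex_of_real (X x) * w))) \<in> borel_measurable (P j)"
  using X_measurable[of j] by measurable

lemma norm_weighted_laplace_integrand_le:
  assumes "Re w \<ge> 0"
  shows "norm ((1 / complex_of_real (X x)) ^ n * exp (- (complex_of_real (X x) * w))) \<le> exp (- Re w)"
proof -
  have "Re w \<le> X x * Re w" using X_ge_1[of x] assms by (simp add: mult_le_cancel_right1)
  then have "norm ((1 / complex_of_real (X x)) ^ n) * norm (exp (- (complex_of_real (X x) * w))) \<le> 1 * exp (- Re w)"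
    by (intro mult_mono inverse_X_power_le) auto
  then show ?thesis by (simp add: norm_mult)
qed

lemma norm_weighted_laplace_le:
  "Re w \<ge> 0 \<Longrightarrow> norm (weighted_laplace n w) \<le> total_mass * exp (- Re w)"
  unfolding weighted_laplace_def
  using norm_comb_le[OF weighted_laplace_measurable norm_weighted_laplace_integrand_le]
  by (simp add: mult.commute)

text \<open>Differentiating under the integral brings down -X, which cancels one factor 1/X. The
  ball of radius \<open>Re w\<close> lies in the right half-plane, where all integrands are bounded
  by 1.\<close>

lemma weighted_laplace_Suc_deriv:
  assumes "Re w > 0"
  shows "(weighted_laplace (Suc n) has_field_derivative - weighted_laplace n w) (at w)"
proof -
  let ?f' = "\<lambda>x w. - ((1 / complex_of_real (X x)) ^ n * exp (- (complex_of_real (X x) * w)))"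
  have pos: "Re v \<ge> 0" if "v \<in> ball w (Re w)" for v
    using that abs_Re_le_cmod[of "w - v"] by (auto simp: dist_norm)
  have *: "norm ((1 / complex_of_real (X x)) ^ k * exp (- (complex_of_real (X x) * v))) \<le> 1" if "v \<in> ball w (Re w)" for x v k
    using norm_weighted_laplace_integrand_le[OF pos[OF that], of x k] pos[OF that]
    by (meson exp_le_one_iff neg_le_0_iff_le order_trans)
  have "((\<lambda>w. comb (\<lambda>x. (1 / complex_of_real (X x)) ^ Suc n * exp (- (complex_of_real (X x) * w)))) has_field_derivative comb (\<lambda>x. ?f' x w)) (at w)"
  proof (rule has_field_derivative_comb[where r = "Re w" and C = 1 and B = 1])
    show "((\<lambda>w. (1 / complex_of_real (X x)) ^ Suc n * exp (- (complex_of_real (X x) * w))) has_field_derivative ?f' x v) (at v)" for x v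
      using X_pos[of x] by (auto intro!: derivative_eq_intros simp: field_simps)
  qed (use assms * in \<open>auto simp del: power_Suc\<close>)
  moreover have "comb (\<lambda>x. ?f' x w) = - weighted_laplace n w"
    by (simp add: comb_def weighted_laplace_def sum_negf)
  ultimately show ?thesis unfolding weighted_laplace_def[abs_def] by simp
qed

text \<open>\<open>weighted_laplace (Suc n)\<close> vanishes at infinity, so its value at w is the
  integral of \<open>weighted_laplace n\<close> from w to infinity. The integral of M e^(-v) over
  that ray is M e^(-w), so the constant M survives each step.\<close>

lemma weighted_laplace_decay:
  assumes "w0 > 0" and M: "\<And>w. w \<ge> w0 \<Longrightarrow> norm (weighted_laplace 0 (of_real w)) \<le> M * exp (- w)"
    and "w \<ge> w0"
  shows "norm (weighted_laplace n (of_real w)) \<le> M * exp (- w)"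
  using \<open>w \<ge> w0\<close>
proof (induction n arbitrary: w)
  case 0
  then show ?case by (rule M)
next
  case (Suc n)
  define g where "g = (\<lambda>v. weighted_laplace (Suc n) (complex_of_real v))"
  have g: "(g has_vector_derivative - weighted_laplace n (of_real v)) (at v within A)" if "v \<ge> w" for v A
    unfolding g_def
    by (rule has_vector_derivative_real_field)
       (use weighted_laplace_Suc_deriv[of "of_real v" n] Suc.prems assms(1) that in auto)
  \<comment> \<open>The bound is integrated over \<open>{w..b}\<close> by means of its
    antiderivative -M e^(-v); afterwards b tends to infinity.\<close>
  have "norm (g b - g w) \<le> (- M * exp (- b)) - (- M * exp (- w))" if "b > w" for b
  proof (rule differentiable_bound_general[OF that, where f' = "\<lambda>v. - weighted_laplace n (of_real v)"
        and \<phi>' = "\<lambda>v. M * exp (- v)"])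
    show "continuous_on {w..b} g"
      by (rule continuous_on_vector_derivative[of _ _ "\<lambda>v. - weighted_laplace n (of_real v)"])
         (use g in auto)
    show "((\<lambda>v. - M * exp (- v)) has_vector_derivative M * exp (- v)) (at v)" for v
      unfolding has_real_derivative_iff_has_vector_derivative[symmetric]
      by (auto intro!: derivative_eq_intros)
    show "norm (- weighted_laplace n (of_real v)) \<le> M * exp (- v)" if "w < v" for v
      using Suc that by simp
  qed (use g in \<open>auto intro!: continuous_intros\<close>)
  then have ev: "\<forall>\<^sub>F b in at_top. norm (g b - g w) \<le> - M * exp (- b) + M * exp (- w)"
    by (intro eventually_mono[OF eventually_gt_at_top[of w]]) simp
  have exp_lim: "((\<lambda>v::real. exp (- v)) \<longlongrightarrow> 0) at_top" by real_asymp
  \<comment> \<open>Only the limit matters here, and the general bound with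
    \<open>total_mass\<close> yields it.\<close>
  have "(g \<longlongrightarrow> 0) at_top"
  proof (rule Lim_null_comparison)
    show "\<forall>\<^sub>F v in at_top. norm (g v) \<le> total_mass * exp (- v)"
      by (rule eventually_mono[OF eventually_ge_at_top[of 0]])
         (use norm_weighted_laplace_le[of "of_real _" "Suc n"] in \<open>auto simp: g_def\<close>)
    show "((\<lambda>v. total_mass * exp (- v)) \<longlongrightarrow> 0) at_top"
      by (rule tendsto_mult_right_zero[OF exp_lim])
  qed
  then have lim: "((\<lambda>b. norm (g b - g w)) \<longlongrightarrow> norm (0 - g w)) at_top"
    by (intro tendsto_intros)
  have "((\<lambda>b. - M * exp (- b) + M * exp (- w)) \<longlongrightarrow> - M * 0 + M * exp (- w)) at_top"
    by (intro tendsto_intros exp_lim)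
  then have "norm (0 - g w) \<le> - M * 0 + M * exp (- w)"
    by (rule tendsto_le[OF trivial_limit_at_top_linorder _ lim ev])
  then show ?case by (simp add: g_def)
qed

section \<open>The transform H and its expansion in the \<open>weighted_laplace n\<close>\<close>

definition bessel_laplace :: "real \<Rightarrow> complex \<Rightarrow> complex" where
  "bessel_laplace q w = comb (\<lambda>x. exp (- (complex_of_real (X x) * w) + complex_of_real q / (complex_of_real (X x) * w)))"

text \<open>The factor exp (q/(Xw)) is expanded and integrated term by term. The n-th term is
  dominated by (q/w)^n/n!, as the remaining factor has norm at most 1.\<close>

lemma bessel_laplace_sums:
  assumes "w > 0" "q > 0"
  shows "(\<lambda>n. of_real ((q / w) ^ n / fact n) * weighted_laplace n (of_real w)) sums bessel_laplace q (of_real w)"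
proof -
  have "(\<lambda>n. comb (\<lambda>x. of_real ((q / w) ^ n / fact n) * ((1 / complex_of_real (X x)) ^ n * exp (- (complex_of_real (X x) * of_real w)))))
    sums bessel_laplace q (of_real w)"
    unfolding bessel_laplace_def
  proof (rule comb_sums[where b = "\<lambda>n. (q / w) ^ n / fact n"])
    show "summable (\<lambda>n. (q / w) ^ n / fact n)"
      using summable_exp[of "q / w"] by (simp add: field_simps)
    show "norm (of_real ((q / w) ^ n / fact n) * ((1 / complex_of_real (X x)) ^ n * exp (- (complex_of_real (X x) * of_real w)))) \<le> (q / w) ^ n / fact n" for n x
    proof -
      have "norm ((1 / complex_of_real (X x)) ^ n * exp (- (complex_of_real (X x) * complex_of_real w))) \<le> 1"
        using norm_weighted_laplace_integrand_le[of "of_real w" x n] assms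
        by (auto intro: order_trans)
      then have "norm (complex_of_real ((q / w) ^ n / fact n)) * norm ((1 / complex_of_real (X x)) ^ n * exp (- (complex_of_real (X x) * complex_of_real w))) \<le> (q / w) ^ n / fact n * 1"
        using assms by (intro mult_mono) (auto simp: norm_divide norm_power)
      then show ?thesis by (simp only: norm_mult mult_1_right)
    qed
    show "(\<lambda>n. of_real ((q / w) ^ n / fact n) * ((1 / complex_of_real (X x)) ^ n * exp (- (complex_of_real (X x) * of_real w)))) sums
       exp (- (complex_of_real (X x) * of_real w) + complex_of_real q / (complex_of_real (X x) * of_real w))" for x
    proof -
      have "(\<lambda>n. exp (- (complex_of_real (X x) * of_real w)) * ((complex_of_real q / (complex_of_real (X x) * of_real w)) ^ n /\<^sub>R fact n))
        sums (exp (- (complex_of_real (X x) * of_real w)) * exp (complex_of_real q / (complex_of_real (X x) * of_real w)))"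
        by (intro sums_mult exp_converges)
      then show ?thesis unfolding exp_add
        by (simp add: scaleR_conv_of_real field_simps power_mult_distrib)
    qed
  qed (use weighted_laplace_measurable in measurable)
  then show ?thesis
    by (simp only: comb_cmult weighted_laplace_def)
qed

text \<open>A decay rate \<open>M e\<^sup>-\<^sup>w\<close> of the Laplace transform passes to all its antiderivatives
  \<open>weighted_laplace n\<close>; since these sum up to zero with weights \<open>(q/w)\<^sup>n/n!\<close>, the transform itself
  is at most \<open>M (e\<^sup>q\<^sup>/\<^sup>w - 1) e\<^sup>-\<^sup>w\<close>, that is, \<open>M\<close> can be halved.\<close>
lemma laplace_eventually_0:
  assumes "q > 0" and zero: "\<And>w. w > 0 \<Longrightarrow> bessel_laplace q (of_real w) = 0"
  obtains w0 where "w0 > 0" "\<And>w. w \<ge> w0 \<Longrightarrow> weighted_laplace 0 (of_real w) = 0"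
proof
  \<comment> \<open>From \<open>w0\<close> on, e^(q/w) is at most 3/2, so that e^(q/w) - 1 is at
    most 1/2.\<close>
  define w0 where "w0 = q / ln (3 / 2)"
  show "w0 > 0" using \<open>q > 0\<close> by (simp add: w0_def)
  have halve: "norm (weighted_laplace 0 (of_real w)) \<le> M / 2 * exp (- w)"
    if M: "\<And>w. w \<ge> w0 \<Longrightarrow> norm (weighted_laplace 0 (of_real w)) \<le> M * exp (- w)" and "M \<ge> 0" and "w \<ge> w0" for M w
  proof -
    have "w > 0" using \<open>w0 > 0\<close> \<open>w \<ge> w0\<close> by linarith
    let ?a = "\<lambda>n. of_real ((q / w) ^ n / fact n) * weighted_laplace n (of_real w)"
    let ?b = "\<lambda>n. M * exp (- w) * ((q / w) ^ Suc n / fact (Suc n))"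
    have "?a sums 0"
      using bessel_laplace_sums[OF \<open>w > 0\<close> \<open>q > 0\<close>] zero[OF \<open>w > 0\<close>] by simp
    \<comment> \<open>The term with index 0 is the Laplace transform itself; the remaining terms
      therefore sum to its negative.\<close>
    then have a: "(\<lambda>n. ?a (Suc n)) sums (- weighted_laplace 0 (of_real w))"
      by (subst sums_Suc_iff) simp
    have "(\<lambda>n. (q / w) ^ n / fact n) sums exp (q / w)"
      using exp_converges[of "q / w"] by (simp add: divide_inverse mult.commute)
    then have "(\<lambda>n. (q / w) ^ Suc n / fact (Suc n)) sums (exp (q / w) - 1)"
      by (subst sums_Suc_iff) simp
    then have b: "?b sums (M * exp (- w) * (exp (q / w) - 1))"
      by (rule sums_mult)
    have "norm (?a (Suc n)) \<le> ?b n" for n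
    proof -
      have "norm (?a (Suc n)) = (q / w) ^ Suc n / fact (Suc n) * norm (weighted_laplace (Suc n) (of_real w))"
        using \<open>w > 0\<close> \<open>q > 0\<close> by (simp only: norm_mult norm_of_real) simp
      also have "\<dots> \<le> (q / w) ^ Suc n / fact (Suc n) * (M * exp (- w))"
        using \<open>w > 0\<close> \<open>q > 0\<close>
        by (intro mult_left_mono weighted_laplace_decay[OF \<open>w0 > 0\<close> M \<open>w \<ge> w0\<close>]) auto
      finally show ?thesis by (simp only: mult.commute)
    qed
    then have "norm (\<Sum>n. ?a (Suc n)) \<le> (\<Sum>n. ?b n)"
      using b by (intro norm_suminf_le) (auto simp: sums_iff)
    then have "norm (weighted_laplace 0 (of_real w)) \<le> M * exp (- w) * (exp (q / w) - 1)"
      using a b by (simp add: sums_iff)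
    also have "exp (q / w) \<le> 3 / 2"
    proof -
      have "q / w \<le> ln (3 / 2)"
        using \<open>w \<ge> w0\<close> \<open>w > 0\<close> by (simp add: w0_def field_simps)
      then show ?thesis by (metis exp_le_cancel_iff exp_ln zero_less_divide_iff zero_less_numeral)
    qed
    then have "M * exp (- w) * (exp (q / w) - 1) \<le> M * exp (- w) * (1 / 2)"
      using \<open>M \<ge> 0\<close> by (intro mult_left_mono) auto
    finally show ?thesis by simp
  qed
  \<comment> \<open>The general bound starts the iteration with
    \<open>M = total_mass\<close>.\<close>
  have decay: "norm (weighted_laplace 0 (of_real w)) \<le> total_mass / 2 ^ k * exp (- w)" if "w \<ge> w0" for k w
    using that
  proof (induction k arbitrary: w)
    case 0
    then show ?case using norm_weighted_laplace_le[of "of_real w" 0] \<open>w0 > 0\<close> by simp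
  next
    case (Suc k)
    then show ?case using halve[of "total_mass / 2 ^ k" w] total_mass_nonneg by (simp add: mult.commute)
  qed
  show "weighted_laplace 0 (of_real w) = 0" if "w \<ge> w0" for w
  proof -
    have "(\<lambda>k. 1 / 2 ^ k :: real) \<longlonglongrightarrow> 0" by real_asymp
    from tendsto_mult_left_zero[OF tendsto_mult_right_zero[OF this, of total_mass], of "exp (- w)"]
    have "(\<lambda>k. total_mass / 2 ^ k * exp (- w)) \<longlonglongrightarrow> 0" by simp
    then have "norm (weighted_laplace 0 (of_real w)) \<le> 0"
      by (rule LIMSEQ_le_const) (use decay[OF that] in auto)
    then show ?thesis by simp
  qed
qed

section \<open>Holomorphy of H and reflection across the imaginary axis\<close>

lemma norm_bessel_integrand_le:
  assumes "Re w \<ge> 0" "q > 0" "norm w \<ge> d" "d > 0"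
  shows "norm (exp (- (complex_of_real (X x) * w) + complex_of_real q / (complex_of_real (X x) * w))) \<le> exp (- (X x * Re w)) * exp (q / d)"
proof -
  \<comment> \<open>As \<open>X \<ge> 1\<close>, this part of the exponent is bounded uniformly in
    \<open>x\<close> while \<open>w\<close> stays away from 0, even on the imaginary axis.\<close>
  have "Re (complex_of_real q / (complex_of_real (X x) * w)) \<le> norm (complex_of_real q / (complex_of_real (X x) * w))" by (rule complex_Re_le_cmod)
  also have "\<dots> = q / (X x * norm w)"
    using assms X_pos[of x] by (simp add: norm_divide norm_mult)
  also have "\<dots> \<le> q / d"
  proof (rule divide_left_mono)
    have "1 * d \<le> X x * norm w" using X_ge_1[of x] assms by (intro mult_mono) auto
    then show "d \<le> X x * norm w" by simp
    then show "0 < X x * norm w * d" using assms by simp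
  qed (use assms in auto)
  finally show ?thesis by (simp add: exp_add[symmetric])
qed

lemma bessel_integrand_measurable [measurable]:
  "j \<in> J \<Longrightarrow> (\<lambda>x. exp (- (complex_of_real (X x) * w) + complex_of_real q / (complex_of_real (X x) * w))) \<in> borel_measurable (P j)"
  using X_measurable[of j] by measurable

text \<open>Differentiation under the integral, on a ball whose radius d is half the distance to the
  imaginary axis. The derivative brings down the unbounded factor X, which the decay exp (-X d)
  absorbs.\<close>

lemma bessel_laplace_holomorphic:
  assumes "q > 0"
  shows "bessel_laplace q holomorphic_on {w. Re w > 0}"
proof -
  have "\<exists>D. (bessel_laplace q has_field_derivative D) (at w)" if "Re w > 0" for w
  proof -
    define d where "d = Re w / 2"
    have d: "d > 0" using that by (simp add: d_def)
    have ge: "d \<le> Re v" "d \<le> norm v" if "v \<in> ball w d" for v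
    proof -
      have "Re w - Re v < d" using that abs_Re_le_cmod[of "w - v"] by (auto simp: dist_norm)
      then show "d \<le> Re v" by (simp add: d_def)
      then show "d \<le> norm v" using complex_Re_le_cmod[of v] by linarith
    qed
    let ?f' = "\<lambda>x w. (- complex_of_real (X x) - complex_of_real q / (complex_of_real (X x) * w\<^sup>2)) * exp (- (complex_of_real (X x) * w) + complex_of_real q / (complex_of_real (X x) * w))"
    have le: "norm (exp (- (complex_of_real (X x) * v) + complex_of_real q / (complex_of_real (X x) * v))) \<le> exp (- (X x * d)) * exp (q / d)"
      if v: "v \<in> ball w d" for v x
    proof -
      have "X x * d \<le> X x * Re v" using ge[OF v] X_pos[of x] by simp
      then have "exp (- (X x * Re v)) * exp (q / d) \<le> exp (- (X x * d)) * exp (q / d)" by simp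
      with norm_bessel_integrand_le[of v q d x] show ?thesis
        using ge[OF v] d assms by linarith
    qed
    have "((\<lambda>w. comb (\<lambda>x. exp (- (complex_of_real (X x) * w) + complex_of_real q / (complex_of_real (X x) * w)))) has_field_derivative comb (\<lambda>x. ?f' x w)) (at w)"
    \<comment> \<open>\<open>C\<close> combines X exp (-X d) \<le> 1/d with q/(X |v|^2) \<le> q/d^2;
      the factor \<open>exp (q / d)\<close> comes from \<open>le\<close>.\<close>
    proof (rule has_field_derivative_comb[where r = d and C = "(1 / d + q / d\<^sup>2) * exp (q / d)" and B = "exp (q / d)"])
      show "((\<lambda>w. exp (- (complex_of_real (X x) * w) + complex_of_real q / (complex_of_real (X x) * w))) has_field_derivative ?f' x v) (at v)"
        if "v \<in> ball w d" for x v
      proof -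
        have "v \<noteq> 0" "X x \<noteq> 0" using ge[OF that] d X_pos[of x] by auto
        then show ?thesis by (auto intro!: derivative_eq_intros simp: field_simps power2_eq_square)
      qed
      show "norm (exp (- (complex_of_real (X x) * v) + complex_of_real q / (complex_of_real (X x) * v))) \<le> exp (q / d)"
        if "v \<in> ball w d" for v x
      proof -
        have "exp (- (X x * d)) * exp (q / d) \<le> 1 * exp (q / d)"
          using X_pos[of x] d by (intro mult_right_mono) auto
        then show ?thesis using le[OF that, of x] by linarith
      qed
      show "norm (?f' x v) \<le> (1 / d + q / d\<^sup>2) * exp (q / d)" if "v \<in> ball w d" for v x
      proof -
        have "norm (- complex_of_real (X x) - complex_of_real q / (complex_of_real (X x) * v\<^sup>2)) \<le> norm (- complex_of_real (X x)) + norm (complex_of_real q / (complex_of_real (X x) * v\<^sup>2))"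
          by (rule norm_triangle_ineq4)
        also have "\<dots> = X x + q / (X x * (norm v)\<^sup>2)"
          using X_pos[of x] assms by (simp add: norm_divide norm_mult norm_power)
        also have "\<dots> \<le> X x + q / d\<^sup>2"
        proof -
          have "1 * d\<^sup>2 \<le> X x * (norm v)\<^sup>2"
            using X_ge_1[of x] ge[OF that] d by (intro mult_mono power_mono) auto
          then show ?thesis using assms d X_pos[of x]
            by (intro add_left_mono divide_left_mono) (auto intro!: mult_pos_pos simp: zero_less_power2 intro: less_le_trans)
        qed
        finally have "norm (?f' x v) \<le> (X x + q / d\<^sup>2) * (exp (- (X x * d)) * exp (q / d))"
          unfolding norm_mult using le[OF that, of x] assms X_pos[of x]
          by (intro mult_mono) (auto intro: add_nonneg_nonneg)
        also have "\<dots> = (X x * exp (- (X x * d)) + q / d\<^sup>2 * exp (- (X x * d))) * exp (q / d)"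
          by (simp add: algebra_simps)
        also have "\<dots> \<le> (1 / d + q / d\<^sup>2 * 1) * exp (q / d)"
        proof (intro mult_right_mono add_mono mult_left_mono)
          have "X x * d \<le> exp (X x * d)" using exp_ge_add_one_self[of "X x * d"] by linarith
          then show "X x * exp (- (X x * d)) \<le> 1 / d" using d by (simp add: exp_minus field_simps)
        qed (use assms d X_pos[of x] in auto)
        finally show ?thesis by simp
      qed
      show "(\<lambda>x. ?f' x w) \<in> borel_measurable (P j)" if "j \<in> J" for j
        using X_measurable[OF that] by measurable
    qed (use d bessel_integrand_measurable in auto)
    then show ?thesis unfolding bessel_laplace_def[abs_def] by blast
  qed
  then show ?thesis
    by (subst holomorphic_on_open) (auto simp: open_halfspace_Re_gt)
qed

text \<open>Extended by zero to the left half-plane, the function is continuous near \<open>\<i>\<close>, hence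
  holomorphic there.\<close>
lemma bessel_laplace_eq_0:
  assumes "q > 0" and axis: "\<And>v. v > 0 \<Longrightarrow> bessel_laplace q (\<i> * of_real v) = 0"
    and "Re w > 0"
  shows "bessel_laplace q w = 0"
proof -
  \<comment> \<open>Radius 1/2 keeps the ball away from the singularity at 0 and inside the upper
    half-plane, so \<open>axis\<close> covers its part of the imaginary axis.\<close>
  let ?B = "ball \<i> (1 / 2)"
  define h where "h = (\<lambda>w. if Re w \<le> 0 then 0 else bessel_laplace q w)"
  have B: "norm w \<ge> 1 / 2" "Im w > 0" if "w \<in> ?B" for w
  proof -
    have "norm (\<i> - w) < 1 / 2" using that by (simp add: dist_norm)
    then show "norm w \<ge> 1 / 2" "Im w > 0"
      using norm_triangle_ineq2[of \<i> w] abs_Im_le_cmod[of "\<i> - w"] by auto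
  qed
  have cont: "continuous_on (?B \<inter> {w. Re w \<ge> 0}) (bessel_laplace q)"
    unfolding bessel_laplace_def[abs_def]
  proof (rule continuous_on_comb[where C = "exp (q / (1 / 2))"])
    show "continuous_on (?B \<inter> {w. Re w \<ge> 0}) (\<lambda>w. exp (- (complex_of_real (X x) * w) + complex_of_real q / (complex_of_real (X x) * w)))" for x
      using B X_pos[of x] by (intro continuous_intros) fastforce
    show "norm (exp (- (complex_of_real (X x) * w) + complex_of_real q / (complex_of_real (X x) * w))) \<le> exp (q / (1 / 2))"
      if "w \<in> ?B \<inter> {w. Re w \<ge> 0}" for x w
    proof -
      have "exp (- (X x * Re w)) * exp (q / (1 / 2)) \<le> 1 * exp (q / (1 / 2))"
        using X_pos[of x] that by (intro mult_right_mono) auto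
      moreover have "norm (exp (- (complex_of_real (X x) * w) + complex_of_real q / (complex_of_real (X x) * w)))
          \<le> exp (- (X x * Re w)) * exp (q / (1 / 2))"
        using that B(1)[of w] assms(1) by (intro norm_bessel_integrand_le) auto
      ultimately show ?thesis by linarith
    qed
  qed (use bessel_integrand_measurable in auto)
  have "continuous_on ((?B \<inter> {w. Re w \<le> 0}) \<union> (?B \<inter> {w. Re w \<ge> 0})) h"
    unfolding h_def
  proof (rule continuous_on_cases_local)
    show "closedin (top_of_set ((?B \<inter> {w. Re w \<le> 0}) \<union> (?B \<inter> {w. Re w \<ge> 0}))) (?B \<inter> {w. Re w \<le> 0})"
      unfolding closedin_closed using closed_halfspace_Re_le[of 0] by blast
    show "closedin (top_of_set ((?B \<inter> {w. Re w \<le> 0}) \<union> (?B \<inter> {w. Re w \<ge> 0}))) (?B \<inter> {w. Re w \<ge> 0})"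
      unfolding closedin_closed using closed_halfspace_Re_ge[of 0] by blast
    show "0 = bessel_laplace q w"
      if "w \<in> ?B \<inter> {w. Re w \<le> 0} \<and> \<not> Re w \<le> 0 \<or> w \<in> ?B \<inter> {w. Re w \<ge> 0} \<and> Re w \<le> 0" for w
    proof -
      have "w = \<i> * of_real (Im w)" using that by (auto simp: complex_eq_iff)
      then show ?thesis using axis[of "Im w"] B[of w] that by auto
    qed
  qed (use cont in auto)
  moreover have "(?B \<inter> {w. Re w \<le> 0}) \<union> (?B \<inter> {w. Re w \<ge> 0}) = ?B" by auto
  ultimately have conth: "continuous_on ?B h" by simp
  \<comment> \<open>\<open>1 \<bullet> z\<close> is \<open>Re z\<close>, so the pasting line is the
    imaginary axis: holomorphy on both sides and continuity across it are combined.\<close>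
  have "h holomorphic_on ?B"
  proof (rule holomorphic_on_paste_across_line[where d = 1 and k = 0])
    show "h holomorphic_on ?B \<inter> {z. 1 \<bullet> z < 0}"
      by (rule holomorphic_transform[of "\<lambda>_. 0"]) (auto simp: h_def)
    show "h holomorphic_on ?B \<inter> {z. 0 < 1 \<bullet> z}"
      by (rule holomorphic_transform[OF holomorphic_on_subset[OF bessel_laplace_holomorphic[OF \<open>q > 0\<close>]]])
         (auto simp: h_def)
  qed (use conth in auto)
  \<comment> \<open>\<open>h\<close> is 0 by definition on the left half of the ball, and the
    identity theorem carries this to the right half, where \<open>h\<close> is
    \<open>bessel_laplace q\<close>.\<close>
  have h0: "h w = 0" if "w \<in> ?B" for w
  proof (rule analytic_continuation_open[of "?B \<inter> {w. Re w < 0}" ?B h "\<lambda>_. 0"])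
    show "open (?B \<inter> {w. Re w < 0})" by (intro open_Int open_halfspace_Re_lt open_ball)
    have "\<i> - of_real (1 / 4) \<in> ?B \<inter> {w. Re w < 0}" by (simp add: dist_norm)
    then show "?B \<inter> {w. Re w < 0} \<noteq> {}" by blast
  qed (use that \<open>h holomorphic_on ?B\<close> in \<open>auto simp: h_def\<close>)
  \<comment> \<open>The right half of the ball is a nonempty open part of the connected half-plane,
    so the zeros spread to all of it.\<close>
  show ?thesis
  proof (rule analytic_continuation_open[of "?B \<inter> {w. Re w > 0}" "{w. Re w > 0}" "bessel_laplace q" "\<lambda>_. 0"])
    show "open (?B \<inter> {w. Re w > 0})" by (intro open_Int open_halfspace_Re_gt open_ball)
    have "\<i> + of_real (1 / 4) \<in> ?B \<inter> {w. Re w > 0}" by (simp add: dist_norm)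
    then show "?B \<inter> {w. Re w > 0} \<noteq> {}" by blast
    show "bessel_laplace q v = 0" if "v \<in> ?B \<inter> {w. Re w > 0}" for v
      using h0[of v] that by (auto simp: h_def)
  qed (use assms bessel_laplace_holomorphic convex_halfspace_Re_gt[of 0] in
        \<open>auto simp: open_halfspace_Re_gt intro: convex_connected\<close>)
qed

end

subsection \<open>Uniqueness of the Laplace transform\<close>

lemma (in finite_measure) abs_integral_diff_le:
  fixes f g :: "'a \<Rightarrow> real"
  assumes "integrable M f" "integrable M g" "\<And>x. \<bar>f x - g x\<bar> \<le> e"
  shows "\<bar>(\<integral>x. f x \<partial>M) - (\<integral>x. g x \<partial>M)\<bar> \<le> e * measure M (space M)"
proof -
  have "\<bar>(\<integral>x. f x \<partial>M) - (\<integral>x. g x \<partial>M)\<bar> = \<bar>\<integral>x. f x - g x \<partial>M\<bar>"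
    using assms by simp
  also have "\<dots> \<le> (\<integral>x. \<bar>f x - g x\<bar> \<partial>M)" by (rule integral_abs_bound)
  also have "\<dots> \<le> (\<integral>x. e \<partial>M)" using assms by (intro integral_mono) auto
  finally show ?thesis by (simp add: mult.commute)
qed

text \<open>With U = exp (-X) in (0,1], the hypothesis equates the integrals of U^m p(U) for
  monomials p, hence for polynomials and, by Weierstrass, for continuous p. The weight U^m is there
  because the transforms are known only from m on. Continuous functions tending to U^(-m) on {U
  \<ge> b} and to 0 elsewhere then give the distribution functions of X.\<close>

lemma distr_eq_if_laplace_eq:
  fixes X :: "'a \<Rightarrow> real"
  assumes "finite_measure M" "finite_measure N"
    and meas: "X \<in> borel_measurable M" "X \<in> borel_measurable N"
    and nonneg: "\<And>x. 0 \<le> X x"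
    and eq: "\<And>n. n \<ge> m \<Longrightarrow> (\<integral>x. exp (- (X x * real n)) \<partial>M) = (\<integral>x. exp (- (X x * real n)) \<partial>N)"
  shows "distr M borel X = distr N borel X"
proof -
  interpret M: finite_measure M by fact
  interpret N: finite_measure N by fact
  note meas [measurable]
  define U where "U = (\<lambda>x. exp (- X x))"
  have U01: "U x \<in> {0..1}" and U_pos: "U x > 0" for x using nonneg[of x] by (auto simp: U_def)
  have U_meas [measurable]: "U \<in> borel_measurable M" "U \<in> borel_measurable N"
    unfolding U_def by measurable
  have int: "integrable M (\<lambda>x. U x ^ m * g (U x))" "integrable N (\<lambda>x. U x ^ m * g (U x))"
    if g [measurable]: "g \<in> borel_measurable borel" and le: "\<And>u. u \<in> {0..1} \<Longrightarrow> \<bar>g u\<bar> \<le> B" for g B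
  proof -
    have "\<bar>U x ^ m * g (U x)\<bar> \<le> B" for x
    proof -
      have "\<bar>U x ^ m\<bar> * \<bar>g (U x)\<bar> \<le> 1 * B"
        using U01[of x] le[OF U01, of x] by (intro mult_mono) (auto intro: power_le_one)
      then show ?thesis by (simp add: abs_mult)
    qed
    then show "integrable M (\<lambda>x. U x ^ m * g (U x))" "integrable N (\<lambda>x. U x ^ m * g (U x))"
      by (auto intro!: M.integrable_const_bound[where B = B] N.integrable_const_bound[where B = B])
  qed
  have power: "(\<integral>x. U x ^ m * U x ^ i \<partial>M) = (\<integral>x. U x ^ m * U x ^ i \<partial>N)" for i
  proof -
    have "U x ^ m * U x ^ i = exp (- (X x * real (m + i)))" for x
      by (simp add: U_def exp_of_nat_mult[symmetric] exp_add[symmetric] algebra_simps)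
    then show ?thesis using eq[of "m + i"] by simp
  qed
  have poly: "(\<integral>x. U x ^ m * p (U x) \<partial>M) = (\<integral>x. U x ^ m * p (U x) \<partial>N)"
    if "real_polynomial_function p" for p
  proof -
    obtain a n where p: "p = (\<lambda>x. \<Sum>i\<le>n. a i * x ^ i)"
      using \<open>real_polynomial_function p\<close> unfolding real_polynomial_function_iff_sum by (elim exE)
    have "integrable M (\<lambda>x. U x ^ m * U x ^ i)" "integrable N (\<lambda>x. U x ^ m * U x ^ i)" for i
      by (rule int[of "\<lambda>u. u ^ i" 1]; auto intro: power_le_one)+
    moreover have "U x ^ m * p (U x) = (\<Sum>i\<le>n. a i * (U x ^ m * U x ^ i))" for x
      by (simp add: p sum_distrib_left mult.left_commute)
    ultimately show ?thesis using power by simp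
  qed
  have cont: "(\<integral>x. U x ^ m * g (U x) \<partial>M) = (\<integral>x. U x ^ m * g (U x) \<partial>N)"
    if g: "continuous_on UNIV g" for g
  proof -
    define K where "K = measure M (space M) + measure N (space N)"
    have g_meas [measurable]: "g \<in> borel_measurable borel" using g by (rule borel_measurable_continuous_onI)
    have close: "\<bar>(\<integral>x. U x ^ m * g (U x) \<partial>M) - (\<integral>x. U x ^ m * g (U x) \<partial>N)\<bar> \<le> e * K" if "e > 0" for e
    proof -
      have "continuous_on {0..1} g" using g continuous_on_subset by blast
      from Stone_Weierstrass_real_polynomial_function[OF compact_Icc this \<open>e > 0\<close>]
      obtain p where p: "real_polynomial_function p" and gp: "\<And>u. u \<in> {0..1} \<Longrightarrow> \<bar>g u - p u\<bar> < e" by metis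
      have p_cont: "continuous_on S p" for S
        using p continuous_real_polymonial_function continuous_at_imp_continuous_on by blast
      have p_meas [measurable]: "p \<in> borel_measurable borel"
        by (rule borel_measurable_continuous_onI[OF p_cont])
      obtain B where B: "\<And>u. u \<in> {0..1} \<Longrightarrow> \<bar>p u\<bar> \<le> B"
        using compact_imp_bounded[OF compact_continuous_image[OF p_cont compact_Icc]]
        by (fastforce simp: bounded_iff)
      have le: "\<bar>U x ^ m * g (U x) - U x ^ m * p (U x)\<bar> \<le> e" for x
      proof -
        have "\<bar>U x ^ m\<bar> * \<bar>g (U x) - p (U x)\<bar> \<le> 1 * e"
          using U01[of x] gp[OF U01, of x] by (intro mult_mono) (auto intro: power_le_one)
        then show ?thesis by (simp add: abs_mult[symmetric] right_diff_distrib)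
      qed
      have "\<bar>g u\<bar> \<le> B + e" if "u \<in> {0..1}" for u using B[OF that] gp[OF that] by linarith
      note ig = int[OF g_meas this] and ip = int[OF p_meas B]
      from M.abs_integral_diff_le[OF ig(1) ip(1) le] N.abs_integral_diff_le[OF ig(2) ip(2) le]
      show ?thesis using poly[OF p] by (simp add: K_def algebra_simps)
    qed
    have "K \<ge> 0" by (simp add: K_def)
    show ?thesis
    proof (rule ccontr)
      let ?d = "\<bar>(\<integral>x. U x ^ m * g (U x) \<partial>M) - (\<integral>x. U x ^ m * g (U x) \<partial>N)\<bar>"
      assume "\<not> ?thesis"
      then have "?d > 0" by simp
      \<comment> \<open>This tolerance leads to \<open>?d < ?d\<close>; the summand 1 in the
        denominator covers \<open>K = 0\<close>.\<close>
      moreover have "?d \<le> ?d / (2 * (K + 1)) * K"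
        by (rule close) (use \<open>?d > 0\<close> \<open>K \<ge> 0\<close> in auto)
      moreover have "?d / (2 * (K + 1)) * K < ?d"
      proof -
        have "K / (2 * (K + 1)) < 1" using \<open>K \<ge> 0\<close> by (simp add: field_simps)
        then have "?d * (K / (2 * (K + 1))) < ?d * 1" using \<open>?d > 0\<close> by (intro mult_strict_left_mono)
        then show ?thesis by simp
      qed
      ultimately show False by linarith
    qed
  qed
  have "cdf (distr M borel X) = cdf (distr N borel X)"
  proof
    fix a :: real
    define b where "b = exp (- a)"
    have "b > 0" by (simp add: b_def)
    \<comment> \<open>ramps converging to the indicator of \<open>{b..}\<close>; dividing by \<open>max u (b / 2) ^ m\<close> cancels the
      factor \<open>u ^ m\<close> on \<open>{b..}\<close> and stays continuous at \<open>0\<close>\<close>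
    define g where "g = (\<lambda>(n::nat) u. max 0 (min 1 (1 + real n * (u - b))) / max u (b / 2) ^ m)"
    define G where "G = (\<lambda>n x. U x ^ m * g n (U x))"
    have g_cont: "continuous_on UNIV (g n)" for n
      unfolding g_def using \<open>b > 0\<close> by (intro continuous_intros) (auto simp: max_def)
    have [measurable]: "g n \<in> borel_measurable borel" for n
      by (rule borel_measurable_continuous_onI[OF g_cont])
    have G_eq: "G n x = max 0 (min 1 (1 + real n * (U x - b))) * (U x / max (U x) (b / 2)) ^ m" for n x
      by (simp add: G_def g_def power_divide)
    have G_le: "norm (G n x) \<le> 1" for n x
    proof -
      have "(U x / max (U x) (b / 2)) ^ m \<le> 1"
        using U_pos[of x] by (intro power_le_one) (auto simp: divide_simps)
      moreover have "0 \<le> (U x / max (U x) (b / 2)) ^ m" using U_pos[of x] by simp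
      ultimately have "max 0 (min 1 (1 + real n * (U x - b))) * (U x / max (U x) (b / 2)) ^ m \<le> 1 * 1"
        by (intro mult_mono) auto
      with \<open>0 \<le> (U x / max (U x) (b / 2)) ^ m\<close> show ?thesis
        unfolding G_eq by (simp add: abs_mult)
    qed
    \<comment> \<open>Each sequence is eventually constant: always 1 if \<open>b \<le> U x\<close>,
      otherwise 0 as soon as n (b - U x) \<ge> 1.\<close>
    have G_lim: "(\<lambda>n. G n x) \<longlonglongrightarrow> indicat_real {x. X x \<le> a} x" for x
    proof (rule tendsto_eventually)
      show "\<forall>\<^sub>F n in sequentially. G n x = indicat_real {x. X x \<le> a} x"
      proof (cases "X x \<le> a")
        case True
        then have "b \<le> U x" by (simp add: b_def U_def)
        then have "max (U x) (b / 2) = U x" using \<open>b > 0\<close> by linarith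
        then have "G n x = 1" for n using \<open>b \<le> U x\<close> U_pos[of x] unfolding G_eq by (simp add: min_def)
        then show ?thesis using True by simp
      next
        case False
        then have "U x < b" by (simp add: b_def U_def)
        obtain N where N: "1 / (b - U x) < real N" using reals_Archimedean2 by blast
        have "G n x = 0" if "n \<ge> N" for n
        proof -
          have "1 / (b - U x) \<le> real n" using N that by linarith
          then have "1 \<le> real n * (b - U x)" using \<open>U x < b\<close> by (simp add: field_simps)
          then have "1 + real n * (U x - b) \<le> 0" by (simp add: algebra_simps)
          then show ?thesis unfolding G_eq by simp
        qed
        then show ?thesis using False by (auto simp: eventually_sequentially)
      qed
    qed
    have "(\<lambda>n. \<integral>x. G n x \<partial>M) \<longlonglongrightarrow> (\<integral>x. indicat_real {x. X x \<le> a} x \<partial>M)"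
      by (rule integral_dominated_convergence[where w = "\<lambda>_. 1"])
         (use G_lim G_le in \<open>auto simp: G_def\<close>)
    moreover have "(\<lambda>n. \<integral>x. G n x \<partial>N) \<longlonglongrightarrow> (\<integral>x. indicat_real {x. X x \<le> a} x \<partial>N)"
      by (rule integral_dominated_convergence[where w = "\<lambda>_. 1"])
         (use G_lim G_le in \<open>auto simp: G_def\<close>)
    moreover have "(\<integral>x. G n x \<partial>M) = (\<integral>x. G n x \<partial>N)" for n
      unfolding G_def by (rule cont[OF g_cont])
    ultimately have "(\<integral>x. indicat_real {x. X x \<le> a} x \<partial>M) = (\<integral>x. indicat_real {x. X x \<le> a} x \<partial>N)"
      by (simp add: LIMSEQ_unique)
    then show "cdf (distr M borel X) a = cdf (distr N borel X) a"
      by (simp add: cdf_def measure_distr vimage_def Int_def conj_commute)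
  qed
  then show ?thesis
    by (intro cdf_unique') (auto intro!: finite_borel_measure.intro finite_borel_measure_axioms.intro
        M.finite_measure_distr N.finite_measure_distr)
qed

subsection \<open>The hyperbola branch\<close>

text \<open>Differentiation swaps cosh and sinh, so the parity of the order selects one of two
  pairs; regularity holds because cosh has no real zero.\<close>

lemma smooth_curve_hyperbola: "smooth_curve (\<lambda>t. (cosh t, sinh t)) {0..}"
  unfolding smooth_curve_def
proof (intro conjI exI[of _ "\<lambda>n t. if even n then (cosh t, sinh t) else (sinh t, cosh t)"])
  show "interior {0::real..} \<noteq> {}" by simp
  show "inj_on (\<lambda>t::real. (cosh t, sinh t)) {0..}"
    by (auto intro!: inj_onI)
  have "((\<lambda>t. (cosh t, sinh t)) has_vector_derivative (sinh t, cosh t)) (at t within {0..})"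
    "((\<lambda>t. (sinh t, cosh t)) has_vector_derivative (cosh t, sinh t)) (at t within {0..})" for t :: real
    by (auto intro!: has_vector_derivative_Pair derivative_eq_intros
        simp: has_real_derivative_iff_has_vector_derivative[symmetric])
  then show "\<forall>n. \<forall>t\<in>{0..}. ((\<lambda>t. if even n then (cosh t, sinh t) else (sinh t, cosh t)) has_vector_derivative
      (if even (Suc n) then (cosh t, sinh t) else (sinh t, cosh t))) (at t within {0::real..})"
    by auto
qed (auto simp: is_interval_ci zero_prod_def)

text \<open>The measure is the image of |D| dt on \<open>T\<close>. \<open>D\<close> stands in for
  the vector derivative as a Borel function on the whole line, which makes the density
  measurable.\<close>

lemma arc_length_measure_smooth_curve:
  assumes \<gamma>: "smooth_curve \<gamma> T" and [measurable]: "T \<in> sets borel" "\<gamma> \<in> borel_measurable borel"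
    and [measurable]: "D \<in> borel_measurable borel"
    and D: "\<And>t. t \<in> T \<Longrightarrow> vector_derivative \<gamma> (at t within T) = D t"
  shows "\<exists>\<sigma>. arc_length_measure (\<gamma> ` T) \<sigma>"
proof (intro exI)
  let ?\<sigma> = "distr (density lborel (\<lambda>t. ennreal (norm (D t)) * indicator T t)) borel \<gamma>"
  show "arc_length_measure (\<gamma> ` T) ?\<sigma>"
    unfolding arc_length_measure_def
  proof (intro conjI exI[of _ "1::nat"] exI[of _ "\<lambda>_. \<gamma>"] exI[of _ "\<lambda>_. T"] ballI)
    fix A :: "(real \<times> real) set" assume [measurable]: "A \<in> sets borel"
    have "\<gamma> -` A \<in> sets borel" using measurable_sets_borel[of \<gamma> borel A] by simp
    then have "emeasure ?\<sigma> A = (\<integral>\<^sup>+t. ennreal (norm (D t)) * indicator T t * indicator (\<gamma> -` A) t \<partial>lborel)"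
      by (simp add: emeasure_distr emeasure_density)
    also have "\<dots> = (\<integral>\<^sup>+t\<in>{t \<in> T. \<gamma> t \<in> A}. ennreal (norm (vector_derivative \<gamma> (at t within T))) \<partial>lborel)"
      by (intro nn_integral_cong) (auto simp: D split: split_indicator)
    finally show "emeasure ?\<sigma> A = (\<Sum>i<1::nat. \<integral>\<^sup>+t\<in>{t \<in> T. \<gamma> t \<in> A}.
        ennreal (norm (vector_derivative \<gamma> (at t within T))) \<partial>lborel)" by simp
  qed (use \<gamma> in \<open>auto simp: disjoint_family_on_def\<close>)
qed

lemma ex_arc_length_measure_hyperbola:
  "\<exists>\<sigma>. arc_length_measure {(cosh t, sinh t) | t::real. t \<ge> 0} \<sigma>"
proof -
  have "vector_derivative (\<lambda>t. (cosh t, sinh t)) (at t within {0..}) = (sinh t, cosh t)"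
    if "t \<in> {0..}" for t :: real
  proof (rule vector_derivative_within)
    \<comment> \<open>Approaching from the right also covers the endpoint 0, where the derivative is
      one-sided.\<close>
    have "t islimpt {t<..<t + 1}" by (rule islimpt_greaterThanLessThan1) simp
    then have "t islimpt {0..}" by (rule islimpt_subset) (use that in auto)
    then show "at t within {0..} \<noteq> bot" by (simp add: trivial_limit_within)
    show "((\<lambda>t. (cosh t, sinh t)) has_vector_derivative (sinh t, cosh t)) (at t within {0..})"
      by (auto intro!: has_vector_derivative_Pair derivative_eq_intros
          simp: has_real_derivative_iff_has_vector_derivative[symmetric])
  qed
  then have "\<exists>\<sigma>. arc_length_measure ((\<lambda>t::real. (cosh t, sinh t)) ` {0..}) \<sigma>"
    by (intro arc_length_measure_smooth_curve[OF smooth_curve_hyperbola, where D = "\<lambda>t. (sinh t, cosh t)"])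
       (auto intro!: borel_measurable_continuous_onI continuous_intros)
  moreover have "(\<lambda>t::real. (cosh t, sinh t)) ` {0..} = {(cosh t, sinh t) | t. t \<ge> 0}" by auto
  ultimately show ?thesis by simp
qed

section \<open>From measures on the branch to distributions of one real variable\<close>

lemma vector_measure_Re_Im:
  assumes "complex_measure M \<mu>"
  shows "vector_measure M (\<lambda>A. Re (\<mu> A))" "vector_measure M (\<lambda>A. Im (\<mu> A))"
  using assms unfolding complex_measure_def vector_measure_def by (auto intro: sums_Re sums_Im)

lemma measure_eq_if_distr_eq:
  assumes "distr M borel X = distr N borel X"
    and [measurable]: "X \<in> borel_measurable M" "X \<in> borel_measurable N" "g \<in> borel_measurable borel"
    and sets: "sets M = sets borel" "sets N = sets borel" and [measurable]: "A \<in> sets borel"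
    and inv: "AE x in M. g (X x) = x" "AE x in N. g (X x) = x"
  shows "measure M A = measure N A"
proof -
  have [measurable]: "A \<in> sets M" "A \<in> sets N" by (simp_all add: sets)
  have sp: "space M = UNIV" "space N = UNIV" using sets_eq_imp_space_eq[OF sets(1)] sets_eq_imp_space_eq[OF sets(2)] by auto
  have B: "g -` A \<in> sets borel" using measurable_sets_borel[of g borel A] by simp
  have "measure K A = measure (distr K borel X) (g -` A)"
    if [measurable]: "X \<in> borel_measurable K" "A \<in> sets K" and sp: "space K = UNIV" and inv: "AE x in K. g (X x) = x" for K
  proof -
    have "measure K A = measure K (X -` (g -` A) \<inter> space K)"
    proof (rule measure_eq_AE)
      show "AE x in K. (x \<in> A) = (x \<in> X -` (g -` A) \<inter> space K)"
        using inv by eventually_elim (auto simp: sp)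
      show "X -` (g -` A) \<inter> space K \<in> sets K" using B by (rule measurable_sets[OF that(1)])
    qed fact
    then show ?thesis using B by (simp add: measure_distr)
  qed
  from this[of M] this[of N] show ?thesis using assms sp by simp
qed

text \<open>Every v > 0 has the form v = pi e^(-s)/2 with s = ln (pi/(2v)), so the points (cosh s,
  -sinh s) reach the whole positive imaginary axis.\<close>

lemma hyperbola_phase:
  fixes t v :: real
  assumes "v > 0"
  shows "exp (- (complex_of_real (exp t) * (\<i> * of_real v)) + complex_of_real (pi\<^sup>2 / 4) / (complex_of_real (exp t) * (\<i> * of_real v)))
    = exp (- \<i> * of_real (pi * (cosh t * cosh (ln (pi / (2 * v))) + sinh t * - sinh (ln (pi / (2 * v))))))"
proof -
  let ?s = "ln (pi / (2 * v))"
  have s: "exp ?s = pi / (2 * v)" using assms by simp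
  have "cosh t * cosh ?s + sinh t * - sinh ?s = cosh (t - ?s)" by (simp add: cosh_diff)
  also have "pi * cosh (t - ?s) = pi / 2 * (exp t / exp ?s + exp ?s / exp t)"
    by (simp add: cosh_def exp_diff exp_minus algebra_simps)
  also have "\<dots> = exp t * v + pi\<^sup>2 / 4 / (exp t * v)"
    unfolding s using assms by (simp add: field_simps power2_eq_square)
  finally have eq: "pi * (cosh t * cosh ?s + sinh t * - sinh ?s) = exp t * v + pi\<^sup>2 / 4 / (exp t * v)" .
  show ?thesis
    unfolding eq using assms by (intro arg_cong[of _ _ exp]) (simp add: field_simps)
qed

text \<open>The branch is the graph of x = cosh (arsinh y) over y \<ge> 0. Closedness makes its
  complement a Borel set, to which \<open>jordan_pos_null\<close> applies.\<close>

lemma closed_hyperbola: "closed {(cosh t, sinh t) | t::real. t \<ge> 0}"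
proof -
  have "{(cosh t, sinh t) | t::real. t \<ge> 0} = {p. fst p = cosh (arsinh (snd p)) \<and> 0 \<le> snd p}" (is "?L = ?R")
  proof (intro set_eqI iffI)
    fix p assume "p \<in> ?R"
    then have "p = (cosh (arsinh (snd p)), sinh (arsinh (snd p)))" "0 \<le> arsinh (snd p)"
      using arsinh_real_neg_iff[of "snd p"] by (auto simp: prod_eq_iff not_less[symmetric])
    then show "p \<in> ?L" by blast
  qed (auto simp: arsinh_sinh_real)
  also have "closed \<dots>"
    by (intro closed_Collect_conj closed_Collect_eq closed_Collect_le continuous_on_cosh
        continuous_on_compose2[OF continuous_on_arsinh[of UNIV]] continuous_intros) auto
  finally show ?thesis .
qed

theorem theorem2p10:
  "heisenberg_uniqueness_pair {(cosh t, sinh t) | t::real. t \<ge> 0} {(cosh s, - sinh s) | s::real. True}"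
  unfolding heisenberg_uniqueness_pair_def
proof (intro conjI ballI impI ex_arc_length_measure_hyperbola)
  let ?\<Gamma> = "{(cosh t, sinh t) | t::real. t \<ge> 0}"
  fix \<mu> A
  assume "\<mu> \<in> ac_measures ?\<Gamma>"
    and zero: "\<forall>p\<in>{(cosh s, - sinh s) | s::real. True}. fourier \<mu> p = 0"
    and A: "A \<in> sets (borel :: (real \<times> real) measure)"
  then have \<mu>: "complex_measure borel \<mu>"
    and supp: "\<And>B. B \<in> sets borel \<Longrightarrow> B \<inter> ?\<Gamma> = {} \<Longrightarrow> \<mu> B = 0"
    by (auto simp: ac_measures_def)
  \<comment> \<open>The four Jordan parts are numbered 0 to 3; \<open>c\<close> holds their
    coefficients in \<open>complex_measure_integral\<close>.\<close>
  define \<nu> where "\<nu> = (\<lambda>j::nat. [\<lambda>A. Re (\<mu> A), \<lambda>A. - Re (\<mu> A), \<lambda>A. Im (\<mu> A), \<lambda>A. - Im (\<mu> A)] ! j)"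
  define P where "P = (\<lambda>j. jordan_pos borel (\<nu> j))"
  define c where "c = (\<lambda>j::nat. [1, - 1, \<i>, - \<i>] ! j)"
  \<comment> \<open>On the branch the sum of the coordinates is e^t \<ge> 1; the maximum extends the
    lower bound to the whole plane.\<close>
  define X where "X = (\<lambda>p::real \<times> real. max 1 (fst p + snd p))"
  have \<nu>: "vector_measure borel (\<nu> j)" if "j \<in> {..<4}" for j
    using that vector_measure_Re_Im[OF \<mu>] vector_measure_uminus
    by (auto simp: \<nu>_def numeral_eq_Suc less_Suc_eq)
  have P_sets [measurable_cong]: "sets (P j) = sets borel" for j by (simp add: P_def)
  have finP: "finite_measure (P j)" if "j \<in> {..<4}" for j
    unfolding P_def by (rule finite_measure_jordan_pos[OF \<nu>[OF that]])
  have X_borel: "X \<in> borel_measurable borel"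
    unfolding X_def by (intro borel_measurable_continuous_onI continuous_intros)
  have X_meas: "X \<in> borel_measurable (P j)" for j
    using X_borel by (simp add: measurable_cong_sets[OF P_sets refl])
  have X_\<Gamma>: "X (cosh t, sinh t) = exp t" if "t \<ge> 0" for t
    using that by (simp add: X_def cosh_plus_sinh)
  have AE_\<Gamma>: "AE p in P j. p \<in> ?\<Gamma>" if "j \<in> {..<4}" for j
  proof (rule AE_I')
    show "- ?\<Gamma> \<in> null_sets (P j)"
      unfolding P_def
    proof (rule jordan_pos_null[OF \<nu>[OF that]])
      show "- ?\<Gamma> \<in> sets borel" using borel_closed[OF closed_hyperbola] by (rule borel_comp)
      fix B assume "B \<in> sets borel" "B \<subseteq> - ?\<Gamma>"
      then have "\<mu> B = 0" by (intro supp) auto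
      then show "\<nu> j B = 0" using that by (auto simp: \<nu>_def numeral_eq_Suc less_Suc_eq)
    qed
  qed auto
  interpret measure_combination "{..<4}" c P X
    by (rule measure_combination.intro) (simp, erule finP, rule X_meas, simp add: X_def)
  have comb4: "comb f = ((\<integral>p. f p \<partial>P 0) - (\<integral>p. f p \<partial>P 1)) + \<i> * ((\<integral>p. f p \<partial>P 2) - (\<integral>p. f p \<partial>P 3))" for f
    by (subst comb_def) (simp add: c_def numeral_eq_Suc lessThan_Suc algebra_simps)
  have integral_comb: "complex_measure_integral borel \<mu> f = comb f" for f
    unfolding comb4 complex_measure_integral_def by (simp add: P_def \<nu>_def numeral_eq_Suc)
  have axis: "bessel_laplace (pi\<^sup>2 / 4) (\<i> * of_real v) = 0" if "v > 0" for v
  proof -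
    let ?s = "ln (pi / (2 * v))"
    let ?f = "\<lambda>(x, y). exp (- \<i> * complex_of_real (pi * (x * cosh ?s + y * - sinh ?s)))"
    let ?g = "\<lambda>p. exp (- (complex_of_real (X p) * (\<i> * of_real v)) + complex_of_real (pi\<^sup>2 / 4) / (complex_of_real (X p) * (\<i> * of_real v)))"
    have [measurable]: "?f \<in> borel_measurable borel"
      by (intro borel_measurable_continuous_onI) (auto simp: case_prod_unfold intro!: continuous_intros)
    \<comment> \<open>The integrands agree on the branch, hence almost everywhere for each Jordan
      part.\<close>
    have "comb ?g = comb ?f"
      unfolding comb_def
    proof (intro sum.cong refl arg_cong2[of _ _ _ _ "(*)"] integral_cong_AE)
      fix j assume j: "j \<in> {..<4::nat}"
      show "AE p in P j. ?g p = ?f p"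
        using AE_\<Gamma>[OF j]
      proof eventually_elim
        case (elim p)
        then obtain t where "t \<ge> 0" "p = (cosh t, sinh t)" by auto
        then show ?case using hyperbola_phase[OF that, of t] by (simp add: X_\<Gamma>)
      qed
      show "?g \<in> borel_measurable (P j)" using X_meas[of j] by measurable
      show "?f \<in> borel_measurable (P j)" by measurable
    qed
    also have "comb ?f = fourier \<mu> (cosh ?s, - sinh ?s)"
      by (simp add: fourier_def integral_comb)
    also have "\<dots> = 0" using zero by blast
    finally show ?thesis by (simp add: bessel_laplace_def)
  qed
  have "bessel_laplace (pi\<^sup>2 / 4) (of_real w) = 0" if "w > 0" for w
    by (rule bessel_laplace_eq_0[OF _ axis]) (use that in auto)
  then obtain w0 where w0: "w0 > 0" "\<And>w. w \<ge> w0 \<Longrightarrow> weighted_laplace 0 (of_real w) = 0"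
    using laplace_eventually_0[of "pi\<^sup>2 / 4"] by auto
  define L where "L = (\<lambda>j w. \<integral>p. exp (- (X p * w)) \<partial>P j)"
  \<comment> \<open>For real w the transforms of the four positive measures are real, so the complex
    equation splits into its real and imaginary parts.\<close>
  have L: "L 0 w = L 1 w" "L 2 w = L 3 w" if "w \<ge> w0" for w
  proof -
    have "exp (- (complex_of_real (X p) * of_real w)) = of_real (exp (- (X p * w)))" for p
      by (simp flip: exp_of_real)
    then have "(\<integral>p. exp (- (complex_of_real (X p) * of_real w)) \<partial>P j) = of_real (L j w)" for j
      by (simp only: L_def integral_complex_of_real)
    then have "complex_of_real (L 0 w - L 1 w) + \<i> * of_real (L 2 w - L 3 w) = 0"
      using w0(2)[OF that] by (simp add: weighted_laplace_def comb4)
    then show "L 0 w = L 1 w" "L 2 w = L 3 w" by (simp_all add: complex_eq_iff)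
  qed
  have distr: "distr (P i) borel X = distr (P j) borel X"
    if "i \<in> {..<4}" "j \<in> {..<4}" "\<And>w. w \<ge> w0 \<Longrightarrow> L i w = L j w" for i j
  proof (rule distr_eq_if_laplace_eq[where m = "nat \<lceil>w0\<rceil>"])
    fix n assume "nat \<lceil>w0\<rceil> \<le> n"
    then have "w0 \<le> real n" by linarith
    then show "(\<integral>p. exp (- (X p * real n)) \<partial>P i) = (\<integral>p. exp (- (X p * real n)) \<partial>P j)"
      using that(3) by (simp add: L_def)
  qed (use that finP X_meas X_ge_1 in \<open>auto intro: order_trans[OF zero_le_one]\<close>)
  \<comment> \<open>Inverts X = e^t on the branch: cosh t = (X + 1/X)/2 and sinh t = (X -
    1/X)/2.\<close>
  have inv: "AE p in P j. ((X p + 1 / X p) / 2, (X p - 1 / X p) / 2) = p" if "j \<in> {..<4}" for j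
    using AE_\<Gamma>[OF that]
  proof eventually_elim
    case (elim p)
    then obtain t where t: "t \<ge> 0" "p = (cosh t, sinh t)" by auto
    have "1 / exp t = cosh t - sinh t" by (simp add: cosh_minus_sinh exp_minus field_simps)
    then show ?case using t by (simp add: X_\<Gamma> flip: cosh_plus_sinh)
  qed
  have "measure (P i) A = measure (P j) A"
    if "i \<in> {..<4}" "j \<in> {..<4}" "\<And>w. w \<ge> w0 \<Longrightarrow> L i w = L j w" for i j
    by (rule measure_eq_if_distr_eq[OF distr[OF that] X_meas X_meas _ P_sets P_sets A inv[OF that(1)] inv[OF that(2)]])
       measurable
  \<comment> \<open>Parts 0 and 1 belong to the real part of \<open>\<mu>\<close>, parts 2 and 3 to
    the imaginary part; equal parts cancel in the Jordan decomposition.\<close>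
  from this[of 0 1, OF _ _ L(1)] this[of 2 3, OF _ _ L(2)]
  have "measure (P 0) A = measure (P 1) A" "measure (P 2) A = measure (P 3) A" by auto
  then show "\<mu> A = 0"
    using jordan_decomposition[OF vector_measure_Re_Im(1)[OF \<mu>] A] jordan_decomposition[OF vector_measure_Re_Im(2)[OF \<mu>] A]
    by (simp add: P_def \<nu>_def numeral_eq_Suc complex_eq_iff)
qed

end
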